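(* Let $\mathcal O$ be the ring of integers of a finite extension of $\mathbb{Q}_p$, with maximal ideal $\mathfrak m$ of ramification index $e\le p-1$ over $\mathbb{Z}_p$ and residue field $\mathbb F$. Let $M,N$ be $\mathcal O[T]$-modules which are free of the same finite rank $d$ as $\mathcal O$-modules. Then $(M\otimes_{\mathcal O}\mathbb F)^{ss}\cong(N\otimes_{\mathcal O}\mathbb F)^{ss}$ as $\mathbb F[T]$-modules if and only if for all $n$ with $1\le n\le d$, $$\operatorname{tr}(T^n\mid M)\equiv\operatorname{tr}(T^n\mid N)\pmod{n\mathfrak m}.$$
   Context: $V^{ss}$ denotes the semisimplification of a finite-dimensional $\mathbb F[T]$-module $V$ (the direct sum of the composition factors). $n\mathfrak m=\{na:a\in\mathfrak m\}$. *)

theory Defs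
  imports "Jordan_Normal_Form.Matrix"
begin

definition mat_trace :: "'a::comm_ring_1 mat \<Rightarrow> 'a" where
  "mat_trace A = (\<Sum>i<dim_row A. A $$ (i, i))"

(* O is (abstractly) the ring of integers of a finite extension of Q_p:
   a complete discrete valuation ring of characteristic 0, with uniformiser pi,
   residue map red : O \<rightarrow> F onto the finite residue field F of characteristic p,
   and absolute ramification index e (i.e. p = unit * pi^e). *)
definition padic_integer_ring ::
    "nat \<Rightarrow> nat \<Rightarrow> ('a::idom \<Rightarrow> 'b::field) \<Rightarrow> bool" where
  "padic_integer_ring p e red \<longleftrightarrow>
     prime p \<and>
     inj (of_nat :: nat \<Rightarrow> 'a) \<and>
     (\<forall>x y. red (x + y) = red x + red y) \<and>
     (\<forall>x y. red (x * y) = red x * red y) \<and>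
     red 1 = 1 \<and>
     surj red \<and>
     finite (UNIV :: 'b set) \<and>
     (of_nat p :: 'b) = 0 \<and>
     (\<exists>\<pi>::'a. \<pi> \<noteq> 0 \<and> red \<pi> = 0 \<and>
        (\<forall>x. x \<noteq> 0 \<longrightarrow> (\<exists>u k. u dvd 1 \<and> x = u * \<pi> ^ k)) \<and>
        (\<forall>x::nat \<Rightarrow> 'a. (\<forall>n. \<pi> ^ n dvd (x (Suc n) - x n)) \<longrightarrow>
             (\<exists>y. \<forall>n. \<pi> ^ n dvd (y - x n))) \<and>
        (\<exists>u. u dvd 1 \<and> (of_nat p :: 'a) = u * \<pi> ^ e))"

(* F[T]-module F^k with T acting by S is simple: k > 0 and no proper nonzero
   T-stable subspace. *)
definition simple_mat :: "'b::field mat \<Rightarrow> bool" where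
  "simple_mat S \<longleftrightarrow> (\<exists>k. S \<in> carrier_mat k k \<and> 0 < k \<and>
     (\<forall>W. W \<subseteq> carrier_vec k \<and> 0\<^sub>v k \<in> W \<and>
          (\<forall>v\<in>W. \<forall>w\<in>W. v + w \<in> W) \<and> (\<forall>c. \<forall>v\<in>W. c \<cdot>\<^sub>v v \<in> W) \<and>
          (\<forall>v\<in>W. S *\<^sub>v v \<in> W)
        \<longrightarrow> W = {0\<^sub>v k} \<or> W = carrier_vec k))"

inductive blk_ut :: "'b::field mat \<Rightarrow> 'b mat list \<Rightarrow> bool" where
  nil: "blk_ut (0\<^sub>m 0 0) []"
| cons: "blk_ut M Bs \<Longrightarrow> B \<in> carrier_mat k k \<Longrightarrow> X \<in> carrier_mat k (dim_row M) \<Longrightarrow>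
     blk_ut (four_block_mat B X (0\<^sub>m (dim_row M) k) M) (B # Bs)"

(* Bs are the (matrices of the) composition factors of the F[T]-module F^d with
   T acting by C, read off from a composition series (adapted basis). *)
definition comp_factors :: "'b::field mat \<Rightarrow> 'b mat list \<Rightarrow> bool" where
  "comp_factors C Bs \<longleftrightarrow> (\<forall>B\<in>set Bs. simple_mat B) \<and>
     (\<exists>M. blk_ut M Bs \<and> similar_mat C M)"

(* V^ss = direct sum of the composition factors; isomorphism of F[T]-modules
   F^d (with matrices) = similarity of matrices. *)
definition ss_iso :: "'b::field mat \<Rightarrow> 'b mat \<Rightarrow> bool" where
  "ss_iso C D \<longleftrightarrow> (\<exists>Bs Cs. comp_factors C Bs \<and> comp_factors D Cs \<and>
     similar_mat (diag_block_mat Bs) (diag_block_mat Cs))"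

end

theory Submission
  imports Defs "Jordan_Normal_Form.Char_Poly"
    "HOL-Computational_Algebra.Formal_Power_Series" "HOL-Computational_Algebra.Primes"
begin

text \<open>
  Over a field, the semisimplification of a matrix is determined by its characteristic polynomial:
  an irreducible factor \<open>f\<close> of the characteristic polynomial of \<open>C\<close> yields an invariant subspace on
  which \<open>C\<close> acts as the companion matrix of \<open>f\<close>, so two matrices with equal characteristic
  polynomials admit composition series with literally the same factors.

  It remains to compare characteristic polynomials modulo \<open>\<pi>\<close>. Put \<open>P = det (1 - x A)\<close>,
  \<open>Q = det (1 - x B)\<close>. By Newton's identities, \<open>log (P / Q)\<close> is minus the sum of the
  \<open>(tr A\<^sup>n - tr B\<^sup>n) x\<^sup>n / n\<close>, and the trace condition says that its coefficients up to \<open>x\<^sup>d\<close> are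
  divisible by \<open>\<pi>\<close>. As \<open>e \<le> p - 1\<close>, Legendre's formula shows that \<open>k!\<close> divides \<open>\<pi>\<^bsup>k-1\<^esup>\<close>,
  hence \<open>log\<close> and \<open>exp\<close> exchange the series congruent to \<open>1\<close> with those congruent to \<open>0\<close>
  modulo \<open>\<pi>\<close>. Both are used through their differential equations, so that no denominators occur.
\<close>

section \<open>Polynomials in a matrix\<close>

lemma index_mult_mat_sum:
  assumes "A \<in> carrier_mat n m" "B \<in> carrier_mat m k" "i < n" "j < k"
  shows "(A * B) $$ (i, j) = (\<Sum>l<m. A $$ (i, l) * B $$ (l, j))"
  using assms by (simp add: scalar_prod_def atLeast0LessThan)

lemma index_mult_mat_vec_sum:
  assumes "A \<in> carrier_mat n m" "v \<in> carrier_vec m" "i < n"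
  shows "(A *\<^sub>v v) $ i = (\<Sum>l<m. A $$ (i, l) * v $ l)"
  using assms by (simp add: scalar_prod_def atLeast0LessThan)

lemma pow_mat_Suc_left:
  assumes "C \<in> carrier_mat d d"
  shows "C ^\<^sub>m Suc n = C * C ^\<^sub>m n"
proof (induct n)
  case (Suc n)
  then show ?case using assms assoc_mult_mat[of C d d "C ^\<^sub>m n" d C d] by simp
qed (use assms in auto)

text \<open>Horner's scheme for f(C), so that induction over \<open>pCons\<close> follows the
  recursion.\<close>

definition poly_mat :: "'a::comm_ring_1 mat \<Rightarrow> 'a poly \<Rightarrow> 'a mat" where
  "poly_mat C f = fold_coeffs (\<lambda>a M. a \<cdot>\<^sub>m 1\<^sub>m (dim_row C) + C * M) f (0\<^sub>m (dim_row C) (dim_row C))"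

lemma poly_mat_0: "poly_mat C 0 = 0\<^sub>m (dim_row C) (dim_row C)"
  by (simp add: poly_mat_def)

lemma dim_poly_mat [simp]:
  "dim_row (poly_mat C f) = dim_row C" "dim_col (poly_mat C f) = dim_row C"
proof -
  have "dim_row (poly_mat C f) = dim_row C \<and> dim_col (poly_mat C f) = dim_row C"
  proof (induct f)
    case (pCons a f)
    then show ?case by (cases "a = 0") (simp_all add: poly_mat_def)
  qed (simp add: poly_mat_0)
  then show "dim_row (poly_mat C f) = dim_row C" "dim_col (poly_mat C f) = dim_row C" by auto
qed

lemma poly_mat_pCons:
  assumes "C \<in> carrier_mat d d"
  shows "poly_mat C (pCons a f) = a \<cdot>\<^sub>m 1\<^sub>m d + C * poly_mat C f"
proof (cases "a = 0 \<and> f = 0")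
  case True
  then show ?thesis using assms by (auto simp: poly_mat_0)
next
  case False
  then show ?thesis using assms by (cases "a = 0") (simp_all add: poly_mat_def)
qed

lemma poly_mat_carrier [simp]: "C \<in> carrier_mat d d \<Longrightarrow> poly_mat C f \<in> carrier_mat d d"
  by (intro carrier_matI) simp_all

lemma poly_mat_index:
  assumes C: "C \<in> carrier_mat d d" and "degree f \<le> N" "i < d" "j < d"
  shows "poly_mat C f $$ (i, j) = (\<Sum>n\<le>N. coeff f n * (C ^\<^sub>m n) $$ (i, j))"
  using assms(2-)
proof (induct f arbitrary: N i j)
  case 0
  then show ?case using C by (simp add: poly_mat_0)
next
  case (pCons a f)
  have P: "poly_mat C f \<in> carrier_mat d d" using C by (rule poly_mat_carrier)
  show ?case
  proof (cases "f = 0")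
    case True
    then show ?thesis using pCons C
      by (simp add: poly_mat_pCons poly_mat_0 coeff_pCons if_distrib[of "\<lambda>x. x * _"] split: nat.split)
        (simp add: sum.atMost_shift)
  next
    case False
    then obtain M where N: "N = Suc M" and M: "degree f \<le> M"
      using pCons.prems(1) by (cases N) auto
    have "(C * poly_mat C f) $$ (i, j) = (\<Sum>l<d. C $$ (i, l) * poly_mat C f $$ (l, j))"
      using C P pCons.prems by (intro index_mult_mat_sum)
    also have "\<dots> = (\<Sum>l<d. C $$ (i, l) * (\<Sum>n\<le>M. coeff f n * (C ^\<^sub>m n) $$ (l, j)))"
      using pCons(2)[OF M] pCons.prems by simp
    also have "\<dots> = (\<Sum>n\<le>M. coeff f n * (\<Sum>l<d. C $$ (i, l) * (C ^\<^sub>m n) $$ (l, j)))"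
      unfolding sum_distrib_left by (subst sum.swap) (simp add: ac_simps)
    also have "\<dots> = (\<Sum>n\<le>M. coeff f n * (C ^\<^sub>m Suc n) $$ (i, j))"
      using C pCons.prems
      by (simp add: pow_mat_Suc_left[OF C] index_mult_mat_sum[OF C pow_carrier_mat[OF C]]
          del: pow_mat.simps(2) index_mult_mat(1))
    finally show ?thesis
      using C P pCons.prems unfolding N sum.atMost_Suc_shift
      by (simp add: poly_mat_pCons)
  qed
qed

lemma poly_mat_mult_vec_index:
  assumes C: "C \<in> carrier_mat d d" and v: "v \<in> carrier_vec d" and "degree f \<le> N" "i < d"
  shows "(poly_mat C f *\<^sub>v v) $ i = (\<Sum>n\<le>N. coeff f n * (C ^\<^sub>m n *\<^sub>v v) $ i)"
proof -
  have "(poly_mat C f *\<^sub>v v) $ i = (\<Sum>l<d. (\<Sum>n\<le>N. coeff f n * (C ^\<^sub>m n) $$ (i, l)) * v $ l)"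
    using assms
    by (simp add: index_mult_mat_vec_sum[OF poly_mat_carrier[OF C] v] poly_mat_index[OF C, of f N]
        del: index_mult_mat_vec)
  also have "\<dots> = (\<Sum>n\<le>N. coeff f n * (\<Sum>l<d. (C ^\<^sub>m n) $$ (i, l) * v $ l))"
    unfolding sum_distrib_left sum_distrib_right by (subst sum.swap) (simp add: ac_simps)
  also have "\<dots> = (\<Sum>n\<le>N. coeff f n * (C ^\<^sub>m n *\<^sub>v v) $ i)"
    using assms by (simp add: index_mult_mat_vec_sum[OF pow_carrier_mat[OF C] v] del: index_mult_mat_vec)
  finally show ?thesis .
qed

lemma poly_mat_add:
  assumes C: "C \<in> carrier_mat d d"
  shows "poly_mat C (f + g) = poly_mat C f + poly_mat C g"
proof (rule eq_matI)
  let ?N = "max (degree f) (degree g)"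
  show "poly_mat C (f + g) $$ (i, j) = (poly_mat C f + poly_mat C g) $$ (i, j)"
    if "i < dim_row (poly_mat C f + poly_mat C g)" "j < dim_col (poly_mat C f + poly_mat C g)" for i j
    using that C by (simp add: poly_mat_index[OF C, of _ ?N] degree_add_le algebra_simps sum.distrib)
qed simp_all

lemma poly_mat_smult:
  assumes C: "C \<in> carrier_mat d d"
  shows "poly_mat C (Polynomial.smult a f) = a \<cdot>\<^sub>m poly_mat C f"
proof (rule eq_matI)
  show "poly_mat C (Polynomial.smult a f) $$ (i, j) = (a \<cdot>\<^sub>m poly_mat C f) $$ (i, j)"
    if "i < dim_row (a \<cdot>\<^sub>m poly_mat C f)" "j < dim_col (a \<cdot>\<^sub>m poly_mat C f)" for i j
    using that C
    by (simp add: poly_mat_index[OF C, of _ "degree f"] degree_smult_le sum_distrib_left ac_simps)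
qed simp_all

lemma poly_mat_mult:
  assumes C: "C \<in> carrier_mat d d"
  shows "poly_mat C (f * g) = poly_mat C f * poly_mat C g"
proof (induct f)
  case 0
  then show ?case using C poly_mat_carrier[OF C, of g] by (simp add: poly_mat_0)
next
  case (pCons a f)
  have P: "poly_mat C f \<in> carrier_mat d d" "poly_mat C g \<in> carrier_mat d d"
    using C by (simp_all add: poly_mat_carrier)
  have "0 \<cdot>\<^sub>m 1\<^sub>m d + C * (poly_mat C f * poly_mat C g) = C * (poly_mat C f * poly_mat C g)"
    using C by (intro eq_matI) auto
  then have "poly_mat C (pCons a f * g) = a \<cdot>\<^sub>m poly_mat C g + C * (poly_mat C f * poly_mat C g)"
    using C pCons by (simp add: poly_mat_add[OF C] poly_mat_smult[OF C] poly_mat_pCons[OF C])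
  also have "C * (poly_mat C f * poly_mat C g) = C * poly_mat C f * poly_mat C g"
    using C P by (simp add: assoc_mult_mat[of _ d d _ d _ d])
  also have "a \<cdot>\<^sub>m poly_mat C g + \<dots> = (a \<cdot>\<^sub>m 1\<^sub>m d + C * poly_mat C f) * poly_mat C g"
    using C P by (simp add: add_mult_distrib_mat[of _ d d _ _ d] mult_smult_assoc_mat[of _ d d _ d])
  finally show ?case by (simp add: poly_mat_pCons[OF C])
qed

lemma mult_mat_vec_0 [simp]: "dim_col A = m \<Longrightarrow> A *\<^sub>v 0\<^sub>v m = 0\<^sub>v (dim_row A)"
  by (intro eq_vecI) auto

lemma zero_mat_mult_vec [simp]: "v \<in> carrier_vec m \<Longrightarrow> 0\<^sub>m n m *\<^sub>v v = 0\<^sub>v n"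
  by (intro eq_vecI) auto

lemma poly_mat_mult_vec_mult:
  assumes C: "C \<in> carrier_mat d d" and v: "v \<in> carrier_vec d"
  shows "poly_mat C (f * g) *\<^sub>v v = poly_mat C f *\<^sub>v (poly_mat C g *\<^sub>v v)"
  using assms poly_mat_carrier[OF C]
  by (simp add: poly_mat_mult[OF C] assoc_mult_mat_vec[of _ d d _ d])

lemma poly_mat_mult_vec_add:
  assumes C: "C \<in> carrier_mat d d" and v: "v \<in> carrier_vec d"
  shows "poly_mat C (f + g) *\<^sub>v v = poly_mat C f *\<^sub>v v + poly_mat C g *\<^sub>v v"
  using assms poly_mat_carrier[OF C]
  by (simp add: poly_mat_add[OF C] add_mult_distrib_mat_vec[of _ d d])

lemma poly_mat_mult_vec_pCons:
  assumes C: "C \<in> carrier_mat d d" and v: "v \<in> carrier_vec d"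
  shows "poly_mat C (pCons a f) *\<^sub>v v = a \<cdot>\<^sub>v v + C *\<^sub>v (poly_mat C f *\<^sub>v v)"
proof -
  have P: "poly_mat C f \<in> carrier_mat d d" using assms by simp
  have "(a \<cdot>\<^sub>m 1\<^sub>m d) *\<^sub>v v = a \<cdot>\<^sub>v v"
    using v by (intro eq_vecI) (auto simp: scalar_prod_def if_distrib[of "\<lambda>x. _ * x"] if_distrib[of "\<lambda>x. x * _"] cong: if_cong)
  then show ?thesis using assms P
    by (simp add: poly_mat_pCons[OF C] add_mult_distrib_mat_vec[of _ d d]
      assoc_mult_mat_vec[of _ d d _ d])
qed

text \<open>The annihilator of \<open>v\<close> is a principal ideal. Its generator \<open>m\<close>
  divides \<open>f\<close> and is not a unit because \<open>v\<close> is nonzero, so irreducibility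
  makes \<open>m\<close> and \<open>f\<close> associates.\<close>

lemma irreducible_annihilator_dvd:
  fixes C :: "'a::field mat"
  assumes C: "C \<in> carrier_mat d d" and v: "v \<in> carrier_vec d" "v \<noteq> 0\<^sub>v d"
    and f: "irreducible f" "poly_mat C f *\<^sub>v v = 0\<^sub>v d"
    and g: "poly_mat C g *\<^sub>v v = 0\<^sub>v d"
  shows "f dvd g"
proof -
  let ?A = "\<lambda>h. h \<noteq> 0 \<and> poly_mat C h *\<^sub>v v = 0\<^sub>v d"
  have "?A f" using f by auto
  then obtain m where m: "?A m" and min: "\<And>h. ?A h \<Longrightarrow> degree m \<le> degree h"
    using ex_has_least_nat[of ?A f degree] by auto
  have m_dvd: "m dvd h" if h: "poly_mat C h *\<^sub>v v = 0\<^sub>v d" for h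
  proof -
    have "poly_mat C (h div m * m + h mod m) *\<^sub>v v = 0\<^sub>v d" using h by simp
    then have "poly_mat C (h mod m) *\<^sub>v v = 0\<^sub>v d"
      using m C v poly_mat_carrier[OF C]
      by (simp only: poly_mat_mult_vec_add[OF C v(1)] poly_mat_mult_vec_mult[OF C v(1)])
        (simp add: left_zero_vec[of _ d] mult_mat_vec_carrier[of _ d d])
    then show ?thesis
      using min[of "h mod m"] degree_mod_less[of m h] m unfolding dvd_eq_mod_eq_0 by force
  qed
  from m_dvd[OF f(2)] obtain q where q: "f = m * q" unfolding dvd_def by blast
  have "\<not> is_unit m"
  proof
    assume "is_unit m"
    then obtain m' where "1 = m * m'" unfolding dvd_def by blast
    then have "poly_mat C (m' * m) *\<^sub>v v = poly_mat C 1 *\<^sub>v v" by (simp add: mult.commute)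
    then have "poly_mat C 1 *\<^sub>v v = 0\<^sub>v d"
      using m C v poly_mat_mult_vec_mult[OF C v(1), of m' m] by simp
    moreover have "poly_mat C 1 *\<^sub>v v = v"
      unfolding one_pCons using C v by (simp add: poly_mat_mult_vec_pCons[OF C v(1)] poly_mat_0)
    ultimately show False using v by simp
  qed
  then have "is_unit q" using f(1) q by (auto dest: irreducibleD)
  then have "f dvd m" unfolding q by simp
  then show ?thesis using m_dvd[OF g] by (rule dvd_trans)
qed

section \<open>Kernels and invariant subspaces\<close>

abbreviation const_mat :: "'a::comm_ring_1 mat \<Rightarrow> 'a poly mat" where
  "const_mat \<equiv> map_mat (\<lambda>a. [:a:])"

lemma char_poly_matrix_mult_const:
  fixes C :: "'a::comm_ring_1 mat"
  assumes C: "C \<in> carrier_mat d d" and F: "F \<in> carrier_mat d d"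
  shows "char_poly_matrix C * const_mat F + const_mat (C * F) = [:0,1:] \<cdot>\<^sub>m const_mat F"
proof -
  have eq: "map_mat (\<lambda>a. [:- a:]) C * const_mat F + const_mat C * const_mat F = 0\<^sub>m d d"
  proof (rule eq_matI)
    fix i j assume "i < dim_row (0\<^sub>m d d :: 'a poly mat)" "j < dim_col (0\<^sub>m d d :: 'a poly mat)"
    then show "(map_mat (\<lambda>a. [:- a:]) C * const_mat F + const_mat C * const_mat F) $$ (i, j) = 0\<^sub>m d d $$ (i, j)"
      using C F by (simp add: scalar_prod_def sum.distrib[symmetric])
  qed (use C F in auto)
  have "char_poly_matrix C * const_mat F + const_mat (C * F)
    = [:0,1:] \<cdot>\<^sub>m const_mat F + (map_mat (\<lambda>a. [:- a:]) C * const_mat F + const_mat C * const_mat F)"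
    unfolding char_poly_matrix_def map_poly_mult(1)[OF C F]
    using C F by (simp add: add_mult_distrib_mat[of _ d d _ _ d] mult_smult_assoc_mat[of _ d d _ d]
        assoc_add_mat[of _ d d])
  then show ?thesis using C F unfolding eq by simp
qed

text \<open>Horner's scheme produces the quotient along with the value, as in the remainder theorem:
  passing from f to a + x f replaces \<open>H\<close> by x H + f(C).\<close>

lemma char_poly_matrix_factor:
  fixes C :: "'a::comm_ring_1 mat"
  assumes C: "C \<in> carrier_mat d d"
  shows "\<exists>H \<in> carrier_mat d d. f \<cdot>\<^sub>m 1\<^sub>m d = char_poly_matrix C * H + const_mat (poly_mat C f)"
proof (induct f)
  case 0
  have "char_poly_matrix C * 0\<^sub>m d d = 0\<^sub>m d d"
    using C by (intro right_mult_zero_mat) simp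
  then have "char_poly_matrix C * 0\<^sub>m d d + const_mat (poly_mat C 0) = 0\<^sub>m d d"
    using C by (simp add: poly_mat_0) (auto intro!: eq_matI)
  then show ?case by (intro bexI[of _ "0\<^sub>m d d"]) (auto intro!: eq_matI)
next
  case (pCons a f)
  then obtain H where H: "H \<in> carrier_mat d d"
    and eq: "f \<cdot>\<^sub>m 1\<^sub>m d = char_poly_matrix C * H + const_mat (poly_mat C f)" by auto
  let ?K = "char_poly_matrix C" and ?F = "poly_mat C f"
  have K: "?K \<in> carrier_mat d d" and F: "?F \<in> carrier_mat d d" using C by simp_all
  let ?H = "[:0,1:] \<cdot>\<^sub>m H + const_mat ?F"
  have "?K * ?H + const_mat (poly_mat C (pCons a f))
    = [:0,1:] \<cdot>\<^sub>m (?K * H) + ?K * const_mat ?F + (const_mat (a \<cdot>\<^sub>m 1\<^sub>m d) + const_mat (C * ?F))"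
  proof -
    have "const_mat (a \<cdot>\<^sub>m 1\<^sub>m d + C * ?F) = const_mat (a \<cdot>\<^sub>m 1\<^sub>m d) + const_mat (C * ?F)"
      using C F by (intro eq_matI) auto
    then show ?thesis
      using C K F H by (simp add: poly_mat_pCons[OF C] mult_add_distrib_mat[of _ d d _ d]
          mult_smult_distrib[of _ d d _ d])
  qed
  also have "\<dots> = [:0,1:] \<cdot>\<^sub>m (?K * H) + (?K * const_mat ?F + const_mat (C * ?F)) + const_mat (a \<cdot>\<^sub>m 1\<^sub>m d)"
  proof -
    have rearrange: "A1 + A2 + (A3 + A4) = A1 + (A2 + A4) + A3"
      if "A1 \<in> carrier_mat d d" "A2 \<in> carrier_mat d d" "A3 \<in> carrier_mat d d" "A4 \<in> carrier_mat d d"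
      for A1 A2 A3 A4 :: "'a poly mat"
      using that by (intro eq_matI) auto
    show ?thesis
      by (rule rearrange) (use C H in \<open>auto intro!: smult_carrier_mat mult_carrier_mat[of _ d d]\<close>)
  qed
  also have "\<dots> = [:0,1:] \<cdot>\<^sub>m (?K * H + const_mat ?F) + const_mat (a \<cdot>\<^sub>m 1\<^sub>m d)"
    unfolding char_poly_matrix_mult_const[OF C F]
    using add_smult_distrib_left_mat[OF mult_carrier_mat[OF K H], of "const_mat ?F"] F by simp
  also have "\<dots> = pCons a f \<cdot>\<^sub>m 1\<^sub>m d"
    unfolding eq[symmetric] by (intro eq_matI) auto
  finally show ?case using H F by (intro bexI[of _ ?H]) auto
qed

text \<open>Taking determinants in \<open>f(x) I - f(C) = (x I - C) H(x)\<close> and reducing modulo \<open>f\<close>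
  shows that \<open>f\<close> divides the constant \<open>det (- f(C))\<close>.\<close>

lemma char_poly_factor_kernel:
  fixes C :: "'a::field mat"
  assumes C: "C \<in> carrier_mat d d" and f: "f dvd char_poly C" "degree f > 0"
  shows "\<exists>v \<in> carrier_vec d. v \<noteq> 0\<^sub>v d \<and> poly_mat C f *\<^sub>v v = 0\<^sub>v d"
proof -
  let ?F = "poly_mat C f"
  have F: "?F \<in> carrier_mat d d" and K: "char_poly_matrix C \<in> carrier_mat d d" using C by simp_all
  obtain H where H: "H \<in> carrier_mat d d"
    and eq: "f \<cdot>\<^sub>m 1\<^sub>m d = char_poly_matrix C * H + const_mat ?F"
    using char_poly_matrix_factor[OF C] by blast
  \<comment> \<open>Substituting \<open>f\<close> for the variable in y I - f(C) gives f I - f(C).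
    Hence \<open>char_poly ?F\<close> composed with \<open>f\<close> is a multiple of
    \<open>f\<close>, and modulo \<open>f\<close> only its constant term survives.\<close>
  have "map_mat (\<lambda>q. q \<circ>\<^sub>p f) (char_poly_matrix ?F) = f \<cdot>\<^sub>m 1\<^sub>m d + - const_mat ?F"
    unfolding char_poly_matrix_def using F C
    by (intro eq_matI) (auto simp: pcompose_pCons)
  also have "\<dots> = char_poly_matrix C * H"
    unfolding eq using mult_carrier_mat[OF K H] F
    by (intro eq_matI) (auto simp del: index_mult_mat)
  finally have eq': "map_mat (\<lambda>q. q \<circ>\<^sub>p f) (char_poly_matrix ?F) = char_poly_matrix C * H" .
  have hom: "comm_ring_hom (\<lambda>q. q \<circ>\<^sub>p f)"
    by unfold_locales (simp_all add: pcompose_add pcompose_mult pcompose_1)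
  from eq' have "char_poly ?F \<circ>\<^sub>p f = char_poly C * det H"
    unfolding char_poly_def comm_ring_hom.hom_det[OF hom, symmetric] using det_mult[OF K H] by simp
  then have "f dvd char_poly ?F \<circ>\<^sub>p f" using f(1) by simp
  moreover obtain c q where cq: "char_poly ?F = pCons c q" by (cases "char_poly ?F")
  ultimately have "f dvd [:c:]"
    by (simp add: pcompose_pCons dvd_add_left_iff)
  then have "c = 0" using f(2) dvd_imp_degree_le[of f "[:c:]"] by auto
  then have "poly (char_poly ?F) 0 = 0" by (simp add: cq)
  then have "eigenvalue ?F 0" using eigenvalue_root_char_poly[OF F] by simp
  then obtain v where "v \<in> carrier_vec d" "v \<noteq> 0\<^sub>v d" "?F *\<^sub>v v = 0 \<cdot>\<^sub>v v"
    unfolding eigenvalue_def eigenvector_def using F C by auto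
  then show ?thesis by (intro bexI[of _ v]) auto
qed

text \<open>Columns are appended one at a time. While k < d there is a nonzero \<open>y\<close>
  orthogonal to all columns of \<open>Q\<close>; a unit vector whose pairing with \<open>y\<close>
  is nonzero is independent of them.\<close>

lemma extend_to_invertible_mat:
  fixes Q :: "'a::field mat"
  assumes "Q \<in> carrier_mat d k" "k \<le> d"
    and "\<And>c. c \<in> carrier_vec k \<Longrightarrow> Q *\<^sub>v c = 0\<^sub>v d \<Longrightarrow> c = 0\<^sub>v k"
  shows "\<exists>R \<in> carrier_mat d d. det R \<noteq> 0 \<and> (\<forall>i<d. \<forall>j<k. R $$ (i, j) = Q $$ (i, j))"
  using assms
proof (induct "d - k" arbitrary: k Q)
  case 0
  then have "k = d" by simp
  then have "Q \<in> carrier_mat d d" and "det Q \<noteq> 0"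
    using 0 det_0_iff_vec_prod_zero[of Q d] by blast+
  then show ?case by blast
next
  case (Suc m)
  note Q = Suc.prems(1) and inj = Suc.prems(3)
  have k: "k < d" using Suc by simp
  \<comment> \<open>Padding \<open>Q\<close> with zero columns gives a singular square matrix; a
    kernel vector of its transpose is the desired \<open>y\<close>.\<close>
  define R where "R = mat d d (\<lambda>(i, j). if j < k then Q $$ (i, j) else 0)"
  have R: "R \<in> carrier_mat d d" by (simp add: R_def)
  have "R *\<^sub>v unit_vec d k = 0\<^sub>v d"
    using k by (intro eq_vecI) (auto simp: R_def scalar_prod_def unit_vec_def intro!: sum.neutral)
  moreover have "unit_vec d k \<noteq> (0\<^sub>v d :: 'a vec)"
    using k by (metis index_unit_vec(1) index_zero_vec(1) zero_neq_one)
  ultimately have "det R = 0"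
    using det_0_iff_vec_prod_zero[OF R] by (metis unit_vec_carrier)
  then have "det (transpose_mat R) = 0" using det_transpose[OF R] by simp
  then obtain y where y: "y \<in> carrier_vec d" "y \<noteq> 0\<^sub>v d" "transpose_mat R *\<^sub>v y = 0\<^sub>v d"
    using det_0_iff_vec_prod_zero[of "transpose_mat R" d] R by auto
  have orth: "(\<Sum>i<d. y $ i * Q $$ (i, j)) = 0" if "j < k" for j
  proof -
    have "(transpose_mat R *\<^sub>v y) $ j = 0" using y(3) that k by simp
    moreover have "(transpose_mat R *\<^sub>v y) $ j = (\<Sum>i<d. transpose_mat R $$ (j, i) * y $ i)"
      using R y that k by (intro index_mult_mat_vec_sum[of _ d d]) auto
    ultimately show ?thesis using that k by (simp add: R_def mult.commute)
  qed
  obtain t where t: "t < d" "y $ t \<noteq> 0" using y by (auto simp: vec_eq_iff)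
  define Q' where "Q' = mat d (Suc k) (\<lambda>(i, j). if j < k then Q $$ (i, j) else if i = t then 1 else 0)"
  have Q': "Q' \<in> carrier_mat d (Suc k)" by (simp add: Q'_def)
  have inj': "c = 0\<^sub>v (Suc k)" if c: "c \<in> carrier_vec (Suc k)" "Q' *\<^sub>v c = 0\<^sub>v d" for c
  proof -
    have eq: "(\<Sum>j<k. Q $$ (i, j) * c $ j) + (if i = t then c $ k else 0) = 0" if "i < d" for i
    proof -
      have "(Q' *\<^sub>v c) $ i = 0" using that c by simp
      then show ?thesis using that
        by (simp add: index_mult_mat_vec_sum[OF Q' c(1)] del: index_mult_mat_vec)
          (auto simp: Q'_def split: if_splits)
    qed
    \<comment> \<open>Pairing the relation \<open>eq\<close> with \<open>y\<close> kills the old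
      columns and leaves only \<open>y $ t * c $ k\<close>.\<close>
    have "0 = (\<Sum>i<d. y $ i * ((\<Sum>j<k. Q $$ (i, j) * c $ j) + (if i = t then c $ k else 0)))"
      using eq by simp
    also have "\<dots> = (\<Sum>i<d. \<Sum>j<k. c $ j * (y $ i * Q $$ (i, j))) + y $ t * c $ k"
      using t by (simp add: distrib_left sum.distrib sum_distrib_left if_distrib[of "\<lambda>x. _ * x"] ac_simps cong: if_cong)
    also have "(\<Sum>i<d. \<Sum>j<k. c $ j * (y $ i * Q $$ (i, j))) = (\<Sum>j<k. c $ j * (\<Sum>i<d. y $ i * Q $$ (i, j)))"
      unfolding sum_distrib_left by (rule sum.swap)
    finally have ck: "c $ k = 0" using orth t by simp
    have "Q *\<^sub>v vec k (\<lambda>j. c $ j) = 0\<^sub>v d"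
    proof (rule eq_vecI)
      fix i assume "i < dim_vec (0\<^sub>v d :: 'a vec)"
      then show "(Q *\<^sub>v vec k (\<lambda>j. c $ j)) $ i = 0\<^sub>v d $ i"
        using eq[of i] ck by (simp add: index_mult_mat_vec_sum[OF Q vec_carrier] del: index_mult_mat_vec cong: if_cong)
    qed (use Q in simp)
    then have "vec k (\<lambda>j. c $ j) = 0\<^sub>v k" using inj by simp
    then have "c $ j = 0" if "j < k" for j using that by (metis index_vec index_zero_vec(1))
    then show ?thesis using ck c(1) by (intro eq_vecI) (auto simp: less_Suc_eq)
  qed
  have m: "m = d - Suc k" "Suc k \<le> d" using Suc.hyps(2) k by linarith+
  obtain R' where "R' \<in> carrier_mat d d" "det R' \<noteq> 0" "\<forall>i<d. \<forall>j<Suc k. R' $$ (i, j) = Q' $$ (i, j)"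
    using Suc.hyps(1)[OF m(1) Q' m(2) inj'] by blast
  then show ?case by (intro bexI[of _ R']) (auto simp: Q'_def)
qed

text \<open>The columns of \<open>Q\<close> span an invariant subspace on which \<open>C\<close>
  acts by \<open>B\<close>. Completing them to a basis \<open>R\<close> and conjugating by
  \<open>R\<close> yields the block form.\<close>

lemma invariant_subspace_block:
  fixes C :: "'a::field mat"
  assumes C: "C \<in> carrier_mat d d" and Q: "Q \<in> carrier_mat d k" and B: "B \<in> carrier_mat k k"
    and kd: "k \<le> d"
    and inj: "\<And>c. c \<in> carrier_vec k \<Longrightarrow> Q *\<^sub>v c = 0\<^sub>v d \<Longrightarrow> c = 0\<^sub>v k"
    and CQ: "C * Q = Q * B"
  shows "\<exists>X \<in> carrier_mat k (d - k). \<exists>M \<in> carrier_mat (d - k) (d - k).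
    similar_mat C (four_block_mat B X (0\<^sub>m (d - k) k) M)"
proof -
  obtain R where R: "R \<in> carrier_mat d d" "det R \<noteq> 0" and RQ: "\<forall>i<d. \<forall>j<k. R $$ (i, j) = Q $$ (i, j)"
    using extend_to_invertible_mat[OF Q kd inj] by blast
  obtain S where S: "S \<in> carrier_mat d d" "S * R = 1\<^sub>m d" "R * S = 1\<^sub>m d"
    using det_non_zero_imp_unit[OF R, of "()"] unfolding Units_def ring_mat_def by auto
  define D where "D = S * C * R"
  \<comment> \<open>\<open>J\<close> includes the first \<open>k\<close> coordinates: multiplying by
    it on the right keeps the first \<open>k\<close> columns.\<close>
  define J where "J = mat d k (\<lambda>(i, j). if i = j then 1 else 0 :: 'a)"
  have D: "D \<in> carrier_mat d d" and J: "J \<in> carrier_mat d k" using S C R by (simp_all add: D_def J_def)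
  have mult_J: "(A * J) $$ (i, j) = A $$ (i, j)" if "A \<in> carrier_mat d d" "i < d" "j < k" for A i j
    using that kd by (simp add: index_mult_mat_sum[OF that(1) J that(2,3)] del: index_mult_mat(1))
      (simp add: J_def if_distrib[of "\<lambda>x. _ * x"] cong: if_cong)
  have RJ: "R * J = Q"
    using R J Q mult_J[OF R(1)] RQ by (intro eq_matI) auto
  have "D * J = S * (C * (R * J))"
    unfolding D_def using S C R J by (simp add: assoc_mult_mat[of _ d d _ d _ d] assoc_mult_mat[of _ d d _ d _ k])
  also have "\<dots> = S * R * J * B"
    unfolding RJ CQ unfolding RJ[symmetric] using S(1) C R(1) J B
    by (simp add: assoc_mult_mat[of _ d d _ d _ k] assoc_mult_mat[of _ d d _ k _ k] assoc_mult_mat[of _ d k _ k _ k])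
  also have "S * R * J * B = J * B" unfolding S(2) using J by simp
  finally have DJ: "D * J = J * B" .
  have Dcol: "D $$ (i, j) = (if i < k then B $$ (i, j) else 0)" if "i < d" "j < k" for i j
  proof -
    have "D $$ (i, j) = (J * B) $$ (i, j)" using mult_J[OF D that] DJ by simp
    also have "\<dots> = (if i < k then B $$ (i, j) else 0)"
      using that by (simp add: index_mult_mat_sum[OF J B that] del: index_mult_mat(1))
        (simp add: J_def if_distrib[of "\<lambda>x. x * _"] cong: if_cong)
    finally show ?thesis .
  qed
  define X where "X = mat k (d - k) (\<lambda>(i, j). D $$ (i, j + k))"
  define M where "M = mat (d - k) (d - k) (\<lambda>(i, j). D $$ (i + k, j + k))"
  have "D = four_block_mat B X (0\<^sub>m (d - k) k) M"
    using D B kd by (intro eq_matI) (auto simp: Dcol X_def M_def)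
  moreover have "similar_mat C D"
  proof (rule similar_matI)
    have "R * D * S = (R * S) * C * (R * S)"
      unfolding D_def using R S(1) C by (simp add: assoc_mult_mat[of _ d d _ d _ d])
    then show "C = R * D * S" using S C by simp
  qed (use C D R S in auto)
  ultimately show ?thesis
    by (intro bexI[of _ X] bexI[of _ M]) (auto simp: X_def M_def)
qed

section \<open>Companion matrices and composition series\<close>

definition krylov :: "'a::comm_ring_1 mat \<Rightarrow> 'a vec \<Rightarrow> nat \<Rightarrow> 'a mat" where
  "krylov C v k = mat (dim_row C) k (\<lambda>(i, j). (C ^\<^sub>m j *\<^sub>v v) $ i)"

lemma krylov_carrier [simp]: "C \<in> carrier_mat d d \<Longrightarrow> krylov C v k \<in> carrier_mat d k"
  by (simp add: krylov_def)

lemma dim_krylov [simp]: "dim_row (krylov C v k) = dim_row C" "dim_col (krylov C v k) = k"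
  by (simp_all add: krylov_def)

lemma coeff_sum_monom:
  "coeff (\<Sum>n<k. monom (c n) n) m = (if m < k then c m else 0)"
  by (simp add: coeff_sum)

text \<open>Coefficient vectors are read as polynomials of degree below \<open>k\<close>, which
  turns linear algebra with the columns v, C v, C^2 v, ... into polynomial arithmetic.\<close>

lemma krylov_mult_vec:
  fixes C :: "'a::comm_ring_1 mat"
  assumes C: "C \<in> carrier_mat d d" and v: "v \<in> carrier_vec d" and c: "c \<in> carrier_vec k"
  shows "krylov C v k *\<^sub>v c = poly_mat C (\<Sum>n<k. monom (c $ n) n) *\<^sub>v v"
proof (rule eq_vecI)
  let ?q = "\<Sum>n<k. monom (c $ n) n"
  show "(krylov C v k *\<^sub>v c) $ i = (poly_mat C ?q *\<^sub>v v) $ i" if "i < dim_vec (poly_mat C ?q *\<^sub>v v)" for i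
  proof -
    have i: "i < d" using that C by simp
    \<comment> \<open>The bound \<open>k\<close> instead of k - 1 covers k = 0 as well; the extra
      summand has coefficient zero.\<close>
    have deg: "degree ?q \<le> k" by (rule degree_le) (simp add: coeff_sum_monom)
    have "(krylov C v k *\<^sub>v c) $ i = (\<Sum>n<k. (C ^\<^sub>m n *\<^sub>v v) $ i * c $ n)"
      using i C by (simp add: index_mult_mat_vec_sum[OF krylov_carrier[OF C] c] del: index_mult_mat_vec)
        (simp add: krylov_def)
    also have "\<dots> = (\<Sum>n\<le>k. coeff ?q n * (C ^\<^sub>m n *\<^sub>v v) $ i)"
      by (simp add: coeff_sum_monom lessThan_Suc_atMost[symmetric] mult.commute)
    also have "\<dots> = (poly_mat C ?q *\<^sub>v v) $ i"
      using poly_mat_mult_vec_index[OF C v deg i] by simp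
    finally show ?thesis .
  qed
qed (use C in simp)

text \<open>A linear relation between the columns is a polynomial of degree below
  \<open>degree f\<close> that kills \<open>v\<close>. It is divisible by \<open>f\<close>, hence
  zero.\<close>

lemma krylov_injective:
  fixes C :: "'a::field mat"
  assumes C: "C \<in> carrier_mat d d" and v: "v \<in> carrier_vec d" "v \<noteq> 0\<^sub>v d"
    and f: "irreducible f" "poly_mat C f *\<^sub>v v = 0\<^sub>v d"
    and c: "c \<in> carrier_vec (degree f)" "krylov C v (degree f) *\<^sub>v c = 0\<^sub>v d"
  shows "c = 0\<^sub>v (degree f)"
proof -
  let ?q = "\<Sum>n<degree f. monom (c $ n) n"
  have "f dvd ?q"
    using irreducible_annihilator_dvd[OF C v f] c krylov_mult_vec[OF C v(1) c(1)] by simp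
  moreover have "degree ?q < degree f \<or> ?q = 0"
  proof (cases "degree f = 0")
    case False
    then have "degree ?q \<le> degree f - 1" by (intro degree_le) (auto simp: coeff_sum_monom)
    then show ?thesis using False by linarith
  qed simp
  ultimately have "?q = 0" by (meson dvd_imp_degree_le leD)
  then have "c $ n = 0" if "n < degree f" for n
    using that coeff_sum_monom[of "\<lambda>n. c $ n" "degree f" n] by simp
  then show ?thesis using c(1) by (intro eq_vecI) auto
qed

text \<open>For monic \<open>f\<close>, the matrix of multiplication by x on R[x]/(f) in the basis
  1, x, x^2, ...; the last column rewrites the top power.\<close>

definition companion_mat :: "'a::comm_ring_1 poly \<Rightarrow> 'a mat" where
  "companion_mat f = mat (degree f) (degree f)
     (\<lambda>(i, j). if Suc j < degree f then if i = Suc j then 1 else 0 else - coeff f i)"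

lemma companion_mat_carrier [simp]: "companion_mat f \<in> carrier_mat (degree f) (degree f)"
  by (simp add: companion_mat_def)

lemma dim_companion_mat [simp]:
  "dim_row (companion_mat f) = degree f" "dim_col (companion_mat f) = degree f"
  by (simp_all add: companion_mat_def)

text \<open>Applying \<open>C\<close> shifts each column to the next; f(C) v = 0 expresses the power
  after the last column through the others.\<close>

lemma mult_krylov:
  fixes C :: "'a::comm_ring_1 mat"
  assumes C: "C \<in> carrier_mat d d" and v: "v \<in> carrier_vec d"
    and f: "monic f" "poly_mat C f *\<^sub>v v = 0\<^sub>v d"
  shows "C * krylov C v (degree f) = krylov C v (degree f) * companion_mat f"
proof (rule eq_matI)
  let ?k = "degree f" and ?K = "krylov C v (degree f)"
  have K: "?K \<in> carrier_mat d ?k" using C by simp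
  fix i j assume "i < dim_row (?K * companion_mat f)" "j < dim_col (?K * companion_mat f)"
  then have i: "i < d" and j: "j < ?k" using C by (simp_all add: krylov_def companion_mat_def)
  have "(C * ?K) $$ (i, j) = (\<Sum>l<d. C $$ (i, l) * (C ^\<^sub>m j *\<^sub>v v) $ l)"
    using i j C by (simp add: index_mult_mat_sum[OF C K] del: index_mult_mat(1)) (simp add: krylov_def)
  also have "\<dots> = (C *\<^sub>v (C ^\<^sub>m j *\<^sub>v v)) $ i"
    using i C v mult_mat_vec_carrier[OF pow_carrier_mat[OF C] v]
    by (intro index_mult_mat_vec_sum[symmetric]) auto
  also have "C *\<^sub>v (C ^\<^sub>m j *\<^sub>v v) = C ^\<^sub>m Suc j *\<^sub>v v"
    unfolding pow_mat_Suc_left[OF C] using C v pow_carrier_mat[OF C]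
    by (simp add: assoc_mult_mat_vec[of _ d d _ d])
  finally have L: "(C * ?K) $$ (i, j) = (C ^\<^sub>m Suc j *\<^sub>v v) $ i" .
  have R: "(?K * companion_mat f) $$ (i, j)
      = (\<Sum>l<?k. (C ^\<^sub>m l *\<^sub>v v) $ i * companion_mat f $$ (l, j))"
    using i j C by (simp add: index_mult_mat_sum[OF K companion_mat_carrier] del: index_mult_mat(1))
      (simp add: krylov_def)
  show "(C * ?K) $$ (i, j) = (?K * companion_mat f) $$ (i, j)"
  proof (cases "Suc j < ?k")
    case True
    have "(\<Sum>l<?k. (C ^\<^sub>m l *\<^sub>v v) $ i * companion_mat f $$ (l, j))
        = (\<Sum>l<?k. if l = Suc j then (C ^\<^sub>m l *\<^sub>v v) $ i else 0)"
      using True j by (intro sum.cong) (auto simp: companion_mat_def simp del: pow_mat.simps)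
    then show ?thesis unfolding L R using True by (simp del: pow_mat.simps)
  next
    case False
    then have k: "?k = Suc j" using j by simp
    have "0 = (poly_mat C f *\<^sub>v v) $ i" using f i by simp
    also have "\<dots> = (\<Sum>l\<le>?k. coeff f l * (C ^\<^sub>m l *\<^sub>v v) $ i)"
      using poly_mat_mult_vec_index[OF C v order_refl i] .
    also have "\<dots> = (\<Sum>l<?k. coeff f l * (C ^\<^sub>m l *\<^sub>v v) $ i) + (C ^\<^sub>m Suc j *\<^sub>v v) $ i"
      using f(1) unfolding k lessThan_Suc_atMost[symmetric] sum.lessThan_Suc[of _ "Suc j"]
      by (simp add: k del: pow_mat.simps sum.lessThan_Suc)
    finally have "(C ^\<^sub>m Suc j *\<^sub>v v) $ i = - (\<Sum>l<?k. coeff f l * (C ^\<^sub>m l *\<^sub>v v) $ i)"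
      by (simp add: eq_neg_iff_add_eq_0 add.commute)
    also have "\<dots> = (\<Sum>l<?k. (C ^\<^sub>m l *\<^sub>v v) $ i * companion_mat f $$ (l, j))"
      unfolding sum_negf[symmetric] using False j
      by (intro sum.cong) (auto simp: companion_mat_def mult.commute simp del: pow_mat.simps)
    finally show ?thesis unfolding L R .
  qed
qed (use C in simp_all)

lemma companion_mat_pow_unit_vec:
  "j < degree f \<Longrightarrow> companion_mat f ^\<^sub>m j *\<^sub>v unit_vec (degree f) 0 = unit_vec (degree f) j"
proof (induct j)
  case 0
  then show ?case by (simp add: companion_mat_def)
next
  case (Suc j)
  let ?B = "companion_mat f" and ?e = "unit_vec (degree f)"
  have "?B ^\<^sub>m Suc j *\<^sub>v ?e 0 = ?B *\<^sub>v (?B ^\<^sub>m j *\<^sub>v ?e 0)"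
    unfolding pow_mat_Suc_left[OF companion_mat_carrier]
    by (intro assoc_mult_mat_vec[OF companion_mat_carrier pow_carrier_mat[OF companion_mat_carrier]]) simp
  also have "\<dots> = ?B *\<^sub>v ?e j" using Suc by simp
  also have "\<dots> = col ?B j"
    using Suc.prems by (intro eq_vecI) (auto simp: companion_mat_def)
  also have "\<dots> = ?e (Suc j)"
    using Suc.prems by (intro eq_vecI) (auto simp: companion_mat_def)
  finally show ?case .
qed

text \<open>This makes the first unit vector cyclic: by \<open>krylov_mult_vec\<close>, every vector
  is q(B) applied to it for some polynomial q.\<close>

lemma krylov_companion_mat:
  fixes f :: "'a::comm_ring_1 poly"
  shows "krylov (companion_mat f) (unit_vec (degree f) 0) (degree f) = 1\<^sub>m (degree f)"
proof (rule eq_matI)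
  fix i j assume ij: "i < dim_row (1\<^sub>m (degree f) :: 'a mat)" "j < dim_col (1\<^sub>m (degree f) :: 'a mat)"
  then have "krylov (companion_mat f) (unit_vec (degree f) 0) (degree f) $$ (i, j)
      = (companion_mat f ^\<^sub>m j *\<^sub>v unit_vec (degree f) 0) $ i"
    by (simp add: krylov_def)
  also have "\<dots> = 1\<^sub>m (degree f) $$ (i, j)"
    using ij by (subst companion_mat_pow_unit_vec) simp_all
  finally show "krylov (companion_mat f) (unit_vec (degree f) 0) (degree f) $$ (i, j)
      = 1\<^sub>m (degree f) $$ (i, j)" .
qed simp_all

text \<open>The relation is computed on the cyclic vector only. Every \<open>w\<close> is q(B) times
  that vector, and f(B) commutes with q(B).\<close>

lemma poly_mat_companion_mat:
  assumes f: "monic f" "degree f > 0" and w: "w \<in> carrier_vec (degree f)"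
  shows "poly_mat (companion_mat f) f *\<^sub>v w = 0\<^sub>v (degree f)"
proof -
  let ?k = "degree f" and ?B = "companion_mat f"
  let ?e = "unit_vec ?k 0"
  have B: "?B \<in> carrier_mat ?k ?k" and e: "?e \<in> carrier_vec ?k" by simp_all
  have e0: "poly_mat ?B f *\<^sub>v ?e = 0\<^sub>v ?k"
  proof (rule eq_vecI)
    fix i assume "i < dim_vec (0\<^sub>v ?k :: 'a vec)"
    then have i: "i < ?k" by simp
    obtain j where k: "?k = Suc j" using f(2) by (cases "degree f") auto
    have "?B ^\<^sub>m ?k *\<^sub>v ?e = ?B *\<^sub>v (?B ^\<^sub>m j *\<^sub>v ?e)"
      using assoc_mult_mat_vec[OF B pow_carrier_mat[OF B] e] unfolding k pow_mat_Suc_left[OF B] by simp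
    also have "\<dots> = ?B *\<^sub>v unit_vec ?k j" using k by (subst companion_mat_pow_unit_vec) simp_all
    also have "\<dots> = col ?B j"
      using k by (intro eq_vecI) (auto simp: companion_mat_def)
    finally have last: "(?B ^\<^sub>m ?k *\<^sub>v ?e) $ i = - coeff f i"
      using i k by (simp add: companion_mat_def)
    have "(poly_mat ?B f *\<^sub>v ?e) $ i = (\<Sum>n\<le>?k. coeff f n * (?B ^\<^sub>m n *\<^sub>v ?e) $ i)"
      by (rule poly_mat_mult_vec_index[OF B e order_refl i])
    also have "\<dots> = (\<Sum>n<?k. coeff f n * unit_vec ?k n $ i) - coeff f i"
      using last f(1) by (simp add: lessThan_Suc_atMost[symmetric] companion_mat_pow_unit_vec)
    also have "\<dots> = 0"
      using i by (simp add: unit_vec_def if_distrib[of "\<lambda>x. _ * x"] cong: if_cong)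
    finally show "(poly_mat ?B f *\<^sub>v ?e) $ i = 0\<^sub>v ?k $ i" using i by simp
  qed (simp add: companion_mat_def)
  let ?q = "\<Sum>n<?k. monom (w $ n) n"
  have "w = poly_mat ?B ?q *\<^sub>v ?e"
    using krylov_mult_vec[OF B e w] w by (simp add: krylov_companion_mat)
  then have "poly_mat ?B f *\<^sub>v w = poly_mat ?B (?q * f) *\<^sub>v ?e"
    using poly_mat_mult_vec_mult[OF B e, of f ?q] by (simp add: mult.commute)
  also have "\<dots> = 0\<^sub>v ?k"
    unfolding poly_mat_mult_vec_mult[OF B e] e0 by (simp add: companion_mat_def)
  finally show ?thesis .
qed

text \<open>A nonzero \<open>w\<close> in an invariant \<open>W\<close> is killed by the irreducible
  \<open>f\<close>, so its Krylov matrix is invertible. Hence the vectors q(B) w, which all lie in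
  \<open>W\<close>, fill the space.\<close>

lemma simple_companion_mat:
  fixes f :: "'a::field poly"
  assumes f: "monic f" "irreducible f"
  shows "simple_mat (companion_mat f)"
proof -
  let ?k = "degree f" and ?B = "companion_mat f"
  have B: "?B \<in> carrier_mat ?k ?k" by simp
  have k: "0 < ?k" using f(2) by (auto simp: irreducible_def is_unit_iff_degree)
  have main: "W = {0\<^sub>v ?k} \<or> W = carrier_vec ?k"
    if W: "W \<subseteq> carrier_vec ?k" "0\<^sub>v ?k \<in> W" "\<forall>v\<in>W. \<forall>w\<in>W. v + w \<in> W"
      "\<forall>c. \<forall>v\<in>W. c \<cdot>\<^sub>v v \<in> W" "\<forall>v\<in>W. ?B *\<^sub>v v \<in> W" for W
  proof (cases "W = {0\<^sub>v ?k}")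
    case False
    then obtain w where wW: "w \<in> W" and w0: "w \<noteq> 0\<^sub>v ?k" using W(2) by blast
    have w: "w \<in> carrier_vec ?k" using wW W(1) by blast
    let ?K = "krylov ?B w ?k"
    have K: "?K \<in> carrier_mat ?k ?k" by simp
    have "det ?K \<noteq> 0"
      unfolding det_0_iff_vec_prod_zero[OF K]
      using krylov_injective[OF B w w0 f(2) poly_mat_companion_mat[OF f(1) k w]] by blast
    then obtain S where S: "S \<in> carrier_mat ?k ?k" "?K * S = 1\<^sub>m ?k"
      using det_non_zero_imp_unit[OF K, of "()"] unfolding Units_def ring_mat_def by auto
    have act: "poly_mat ?B q *\<^sub>v w \<in> W" for q
    proof (induct q)
      case 0
      then show ?case using W(2) w by (simp add: poly_mat_0 companion_mat_def)
    next
      case (pCons a q)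
      then show ?case using W wW by (simp add: poly_mat_mult_vec_pCons[OF B w])
    qed
    have "u \<in> W" if u: "u \<in> carrier_vec ?k" for u
    proof -
      have "u = ?K *\<^sub>v (S *\<^sub>v u)"
        using assoc_mult_mat_vec[OF K S(1) u] S(2) u by simp
      also have "\<dots> \<in> W"
        using act krylov_mult_vec[OF B w mult_mat_vec_carrier[OF S(1) u]] by simp
      finally show ?thesis .
    qed
    then show ?thesis using W(1) by blast
  qed simp
  show ?thesis
    unfolding simple_mat_def
  proof (intro exI[of _ ?k] conjI allI impI)
    fix W assume "W \<subseteq> carrier_vec ?k \<and> 0\<^sub>v ?k \<in> W \<and> (\<forall>v\<in>W. \<forall>w\<in>W. v + w \<in> W) \<and>
      (\<forall>c. \<forall>v\<in>W. c \<cdot>\<^sub>v v \<in> W) \<and> (\<forall>v\<in>W. ?B *\<^sub>v v \<in> W)"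
    then show "W = {0\<^sub>v ?k} \<or> W = carrier_vec ?k" by (elim conjE) (rule main)
  qed (rule B, rule k)
qed

text \<open>An irreducible factor \<open>h\<close> of the characteristic polynomial has a kernel
  vector, which \<open>f\<close> kills too. Thus \<open>f\<close> divides \<open>h\<close>, and
  equality follows from degrees and leading coefficients.\<close>

lemma char_poly_companion_mat:
  fixes f :: "'a::field poly"
  assumes f: "monic f" "irreducible f"
  shows "char_poly (companion_mat f) = f"
proof -
  let ?k = "degree f" and ?B = "companion_mat f"
  have B: "?B \<in> carrier_mat ?k ?k" by simp
  have k: "0 < ?k" using f(2) by (auto simp: irreducible_def is_unit_iff_degree)
  note chi = degree_monic_char_poly[OF B]
  obtain h r where h: "irreducible h" "char_poly ?B = h * r"
    using irreducible_monic_factor[of "char_poly ?B"] chi k by auto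
  have "degree h > 0" using h(1) by (auto simp: irreducible_def is_unit_iff_degree)
  then obtain w where w: "w \<in> carrier_vec ?k" "w \<noteq> 0\<^sub>v ?k" "poly_mat ?B h *\<^sub>v w = 0\<^sub>v ?k"
    using char_poly_factor_kernel[OF B, of h] h(2) by auto
  then have "f dvd h"
    using irreducible_annihilator_dvd[OF B w(1,2) f(2) poly_mat_companion_mat[OF f(1) k w(1)]] by blast
  then have "f dvd char_poly ?B" using h(2) by simp
  then obtain q where q: "char_poly ?B = f * q" unfolding dvd_def by blast
  have "char_poly ?B \<noteq> 0" using chi by auto
  then have "q \<noteq> 0" "f \<noteq> 0" using q by auto
  then have "degree q = 0" using chi q degree_mult_eq[of f q] by simp
  then obtain c where "q = [:c:]" by (auto elim: degree_eq_zeroE)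
  moreover have "lead_coeff (char_poly ?B) = lead_coeff f * lead_coeff q" unfolding q by (rule lead_coeff_mult)
  ultimately have "q = 1" using f(1) chi by simp
  then show ?thesis using q by simp
qed

section \<open>Block triangular matrices and composition factors\<close>

lemma char_poly_four_block_lower_left_zero:
  fixes B :: "'a::idom mat"
  assumes "B \<in> carrier_mat k k" "X \<in> carrier_mat k m" "M \<in> carrier_mat m m"
  shows "char_poly (four_block_mat B X (0\<^sub>m m k) M) = char_poly B * char_poly M"
proof -
  have "char_poly_matrix (four_block_mat B X (0\<^sub>m m k) M)
    = four_block_mat (char_poly_matrix B) (map_mat (\<lambda>a. [:- a:]) X) (0\<^sub>m m k) (char_poly_matrix M)"
    using assms by (intro eq_matI) (auto simp: char_poly_matrix_def)
  then show ?thesis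
    unfolding char_poly_def using assms
    by (simp add: det_four_block_mat_lower_left_zero[of _ k _ m])
qed

lemma blk_ut_square: "blk_ut M Bs \<Longrightarrow> dim_col M = dim_row M"
  by (induct rule: blk_ut.induct) simp_all

lemma dim_diag_block_mat_blk_ut:
  "blk_ut M Bs \<Longrightarrow> dim_row (diag_block_mat Bs) = dim_row M \<and> dim_col (diag_block_mat Bs) = dim_row M"
  by (induct rule: blk_ut.induct) (simp_all add: Let_def)

text \<open>The blocks above the diagonal do not enter the determinant of x I - M, so
  semisimplification preserves the characteristic polynomial.\<close>

lemma char_poly_blk_ut:
  fixes M :: "'a::field mat"
  shows "blk_ut M Bs \<Longrightarrow> char_poly M = char_poly (diag_block_mat Bs)"
proof (induct rule: blk_ut.induct)
  case (cons M Bs B k X)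
  let ?m = "dim_row M" and ?D = "diag_block_mat Bs"
  have M: "M \<in> carrier_mat ?m ?m" and D: "?D \<in> carrier_mat ?m ?m"
    using blk_ut_square[OF cons(1)] dim_diag_block_mat_blk_ut[OF cons(1)] by (auto intro: carrier_matI)
  have "diag_block_mat (B # Bs) = four_block_mat B (0\<^sub>m k ?m) (0\<^sub>m ?m k) ?D"
    using cons(3) dim_diag_block_mat_blk_ut[OF cons(1)] by (simp add: Let_def)
  then have "char_poly (diag_block_mat (B # Bs)) = char_poly B * char_poly ?D"
    using char_poly_four_block_lower_left_zero[OF cons(3) zero_carrier_mat D] by metis
  moreover have "char_poly (four_block_mat B X (0\<^sub>m ?m k) M) = char_poly B * char_poly M"
    by (rule char_poly_four_block_lower_left_zero[OF cons(3,4) M])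
  ultimately show ?case using cons(2) by metis
qed simp

text \<open>The induction step for composition series. The leading block depends on \<open>f\<close>
  alone, so matrices sharing the factor \<open>f\<close> share this block.\<close>

lemma irreducible_factor_block:
  fixes C :: "'a::field mat"
  assumes C: "C \<in> carrier_mat d d" and f: "monic f" "irreducible f" "f dvd char_poly C"
  shows "\<exists>X \<in> carrier_mat (degree f) (d - degree f). \<exists>M \<in> carrier_mat (d - degree f) (d - degree f).
    similar_mat C (four_block_mat (companion_mat f) X (0\<^sub>m (d - degree f) (degree f)) M) \<and>
    char_poly C = f * char_poly M"
proof -
  let ?k = "degree f"
  have deg: "0 < ?k" using f(2) by (auto simp: irreducible_def is_unit_iff_degree)
  have le: "?k \<le> d"
    using dvd_imp_degree_le[OF f(3)] degree_monic_char_poly[OF C] by fastforce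
  obtain v where v: "v \<in> carrier_vec d" "v \<noteq> 0\<^sub>v d" "poly_mat C f *\<^sub>v v = 0\<^sub>v d"
    using char_poly_factor_kernel[OF C f(3) deg] by blast
  obtain X M where XM: "X \<in> carrier_mat ?k (d - ?k)" "M \<in> carrier_mat (d - ?k) (d - ?k)"
    "similar_mat C (four_block_mat (companion_mat f) X (0\<^sub>m (d - ?k) ?k) M)"
    using invariant_subspace_block[OF C krylov_carrier[OF C] companion_mat_carrier le
        krylov_injective[OF C v(1,2) f(2) v(3)] mult_krylov[OF C v(1) f(1) v(3)]] by blast
  have "char_poly C = f * char_poly M"
    using char_poly_similar[OF XM(3)]
      char_poly_four_block_lower_left_zero[OF companion_mat_carrier XM(1,2)]
      char_poly_companion_mat[OF f(1,2)] by simp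
  then show ?thesis using XM by blast
qed

lemma comp_factors_cons:
  assumes M: "M \<in> carrier_mat m m" "comp_factors M Bs" and B: "B \<in> carrier_mat k k" "simple_mat B"
    and X: "X \<in> carrier_mat k m" and C: "similar_mat C (four_block_mat B X (0\<^sub>m m k) M)"
  shows "comp_factors C (B # Bs)"
proof -
  obtain M' where M': "blk_ut M' Bs" "similar_mat M M'" and simple: "\<forall>B\<in>set Bs. simple_mat B"
    using M(2) unfolding comp_factors_def by blast
  have dim: "dim_row M' = m" using M(1) similar_matD[OF M'(2)] by auto
  \<comment> \<open>Changing the basis of the quotient from \<open>M\<close> to \<open>M'\<close>
    alters the upper right block.\<close>
  obtain X' where X': "X' \<in> carrier_mat k m"
    "similar_mat (four_block_mat B X (0\<^sub>m m k) M) (four_block_mat B X' (0\<^sub>m m k) M')"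
    using similar_mat_four_block_0_ex[OF similar_mat_refl[OF B(1)] M'(2) X B(1) M(1)] by blast
  have "blk_ut (four_block_mat B X' (0\<^sub>m m k) M') (B # Bs)"
    using blk_ut.cons[OF M'(1) B(1), of X'] X'(1) dim by simp
  moreover have "\<forall>B'\<in>set (B # Bs). simple_mat B'" using simple B(2) by simp
  ultimately show ?thesis
    unfolding comp_factors_def using similar_mat_trans[OF C X'(2)] by blast
qed

text \<open>One monic irreducible factor is split off from both matrices and cancelled, which leaves
  smaller blocks with equal characteristic polynomials.\<close>

lemma comp_factors_common:
  fixes C D :: "'a::field mat"
  assumes "C \<in> carrier_mat d d" "D \<in> carrier_mat d d" "char_poly C = char_poly D"
  shows "\<exists>Bs. comp_factors C Bs \<and> comp_factors D Bs"
  using assms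
proof (induct d arbitrary: C D rule: less_induct)
  case (less d)
  note C = less.prems(1) and D = less.prems(2)
  show ?case
  proof (cases "d = 0")
    case True
    have "comp_factors E []" if "E \<in> carrier_mat d d" for E :: "'a mat"
    proof -
      have "E = 0\<^sub>m 0 0" using that True by auto
      then show ?thesis unfolding comp_factors_def
        using blk_ut.nil similar_mat_refl[OF zero_carrier_mat[of 0 0]] by (intro conjI exI) simp_all
    qed
    then show ?thesis using C D by blast
  next
    case False
    then have "degree (char_poly C) > 0" using degree_monic_char_poly[OF C] by simp
    then obtain f r where f: "irreducible f" "char_poly C = f * r" "monic f"
      using irreducible_monic_factor by blast
    let ?k = "degree f"
    have "f dvd char_poly C" "f dvd char_poly D" using f(2) less.prems(3) by simp_all
    note blk = irreducible_factor_block[OF C f(3,1) this(1)] irreducible_factor_block[OF D f(3,1) this(2)]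
    obtain X M where C': "X \<in> carrier_mat ?k (d - ?k)" "M \<in> carrier_mat (d - ?k) (d - ?k)"
      "similar_mat C (four_block_mat (companion_mat f) X (0\<^sub>m (d - ?k) ?k) M)" "char_poly C = f * char_poly M"
      using blk(1) by blast
    obtain Y N where D': "Y \<in> carrier_mat ?k (d - ?k)" "N \<in> carrier_mat (d - ?k) (d - ?k)"
      "similar_mat D (four_block_mat (companion_mat f) Y (0\<^sub>m (d - ?k) ?k) N)" "char_poly D = f * char_poly N"
      using blk(2) by blast
    have "f \<noteq> 0" using f(1) by auto
    then have eq: "char_poly M = char_poly N" using C'(4) D'(4) less.prems(3) by simp
    have "0 < ?k" using f(1) by (auto simp: irreducible_def is_unit_iff_degree)
    then have "d - ?k < d" using False by simp
    from less.hyps[OF this C'(2) D'(2) eq] obtain Bs where "comp_factors M Bs" "comp_factors N Bs" by blast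
    then show ?thesis
      using comp_factors_cons[OF C'(2) _ companion_mat_carrier simple_companion_mat[OF f(3,1)] C'(1,3)]
        comp_factors_cons[OF D'(2) _ companion_mat_carrier simple_companion_mat[OF f(3,1)] D'(1,3)] by blast
  qed
qed

lemma ss_iso_iff_char_poly_eq:
  fixes C D :: "'a::field mat"
  assumes "C \<in> carrier_mat d d" "D \<in> carrier_mat d d"
  shows "ss_iso C D \<longleftrightarrow> char_poly C = char_poly D"
proof
  assume "ss_iso C D"
  then obtain Bs Cs where "comp_factors C Bs" "comp_factors D Cs"
    and sim: "similar_mat (diag_block_mat Bs) (diag_block_mat Cs)"
    unfolding ss_iso_def by blast
  then have "char_poly C = char_poly (diag_block_mat Bs)" "char_poly D = char_poly (diag_block_mat Cs)"
    unfolding comp_factors_def using char_poly_similar char_poly_blk_ut by metis+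
  then show "char_poly C = char_poly D" using char_poly_similar[OF sim] by simp
next
  assume "char_poly C = char_poly D"
  then obtain Bs where Bs: "comp_factors C Bs" "comp_factors D Bs"
    using comp_factors_common assms by blast
  then obtain M where "blk_ut M Bs" unfolding comp_factors_def by blast
  then have "similar_mat (diag_block_mat Bs) (diag_block_mat Bs)"
    using dim_diag_block_mat_blk_ut by (intro similar_mat_refl[of _ "dim_row M"] carrier_matI) auto
  then show "ss_iso C D" unfolding ss_iso_def using Bs by blast
qed

section \<open>Newton's identities\<close>

lemma mat_trace_add:
  assumes "A \<in> carrier_mat n n" "B \<in> carrier_mat n n"
  shows "mat_trace (A + B) = mat_trace A + mat_trace B"
  using assms by (simp add: mat_trace_def sum.distrib)

lemma mat_trace_smult:
  assumes "A \<in> carrier_mat n n"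
  shows "mat_trace (c \<cdot>\<^sub>m A) = c * mat_trace A"
  using assms by (simp add: mat_trace_def sum_distrib_left)

text \<open>The adjugate of x I - A is regarded as a polynomial with matrix coefficients; this is
  its coefficient of x^k.\<close>

definition adj_coeff :: "'a::comm_ring_1 mat \<Rightarrow> nat \<Rightarrow> 'a mat" where
  "adj_coeff A k = mat (dim_row A) (dim_row A)
     (\<lambda>(i, j). coeff (adj_mat (char_poly_matrix A) $$ (i, j)) k)"

lemma adj_coeff_carrier [simp]: "A \<in> carrier_mat d d \<Longrightarrow> adj_coeff A k \<in> carrier_mat d d"
  by (simp add: adj_coeff_def)

lemma char_poly_matrix_mult_adj:
  assumes A: "A \<in> carrier_mat d d" and ij: "i < d" "j < d"
  defines "J \<equiv> adj_mat (char_poly_matrix A)"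
  shows "pCons 0 (J $$ (i, j)) - (\<Sum>l<d. Polynomial.smult (A $$ (i, l)) (J $$ (l, j)))
    = (if i = j then char_poly A else 0)"
proof -
  have K: "char_poly_matrix A \<in> carrier_mat d d" using A by simp
  note J = adj_mat[OF K, folded J_def]
  have "(char_poly_matrix A * J) $$ (i, j) = (\<Sum>l<d. char_poly_matrix A $$ (i, l) * J $$ (l, j))"
    by (rule index_mult_mat_sum[OF K J(1) ij])
  also have "\<dots> = (\<Sum>l<d. (if l = i then pCons 0 (J $$ (i, j)) else 0) -
      Polynomial.smult (A $$ (i, l)) (J $$ (l, j)))"
    using A ij by (intro sum.cong refl) (auto simp: char_poly_matrix_def)
  also have "\<dots> = pCons 0 (J $$ (i, j)) - (\<Sum>l<d. Polynomial.smult (A $$ (i, l)) (J $$ (l, j)))"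
    using ij by (simp add: sum_subtractf)
  finally show ?thesis using J(2) ij by (cases "i = j") (auto simp: char_poly_def)
qed

lemma adj_coeff_Suc:
  assumes A: "A \<in> carrier_mat d d"
  shows "adj_coeff A k = coeff (char_poly A) (Suc k) \<cdot>\<^sub>m 1\<^sub>m d + A * adj_coeff A (Suc k)"
proof (rule eq_matI)
  fix i j assume "i < dim_row (coeff (char_poly A) (Suc k) \<cdot>\<^sub>m 1\<^sub>m d + A * adj_coeff A (Suc k))"
    "j < dim_col (coeff (char_poly A) (Suc k) \<cdot>\<^sub>m 1\<^sub>m d + A * adj_coeff A (Suc k))"
  then have ij: "i < d" "j < d" using A by (simp_all add: adj_coeff_def)
  show "adj_coeff A k $$ (i, j) =
      (coeff (char_poly A) (Suc k) \<cdot>\<^sub>m 1\<^sub>m d + A * adj_coeff A (Suc k)) $$ (i, j)"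
    using arg_cong[OF char_poly_matrix_mult_adj[OF A ij], of "\<lambda>q. coeff q (Suc k)"] A ij
      index_mult_mat_sum[OF A adj_coeff_carrier[OF A] ij, of "Suc k"]
    by (auto simp: coeff_sum adj_coeff_def algebra_simps simp del: index_mult_mat(1))
qed (use A in \<open>simp_all add: adj_coeff_def\<close>)

lemma adj_coeff_0:
  assumes A: "A \<in> carrier_mat d d"
  shows "coeff (char_poly A) 0 \<cdot>\<^sub>m 1\<^sub>m d + A * adj_coeff A 0 = 0\<^sub>m d d"
proof (rule eq_matI)
  fix i j assume "i < dim_row (0\<^sub>m d d :: 'a mat)" "j < dim_col (0\<^sub>m d d :: 'a mat)"
  then have ij: "i < d" "j < d" by simp_all
  show "(coeff (char_poly A) 0 \<cdot>\<^sub>m 1\<^sub>m d + A * adj_coeff A 0) $$ (i, j) = 0\<^sub>m d d $$ (i, j)"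
    using arg_cong[OF char_poly_matrix_mult_adj[OF A ij], of "\<lambda>q. coeff q 0"] A ij
      index_mult_mat_sum[OF A adj_coeff_carrier[OF A] ij, of 0]
    by (auto simp: coeff_sum adj_coeff_def neg_eq_iff_add_eq_0 add.commute
        simp del: index_mult_mat(1))
qed (use A in \<open>simp_all add: adj_coeff_def\<close>)

text \<open>The diagonal cofactors of x I - A are the characteristic polynomials of the principal
  submatrices, and they add up to the derivative of the characteristic polynomial.\<close>

lemma mat_trace_adj_coeff:
  fixes A :: "'a::idom mat"
  assumes A: "A \<in> carrier_mat d d"
  shows "mat_trace (adj_coeff A k) = of_nat (Suc k) * coeff (char_poly A) (Suc k)"
proof -
  have "adj_mat (char_poly_matrix A) $$ (i, i) = char_poly (mat_delete A i i)" if i: "i < d" for i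
  proof -
    have "mat_delete (char_poly_matrix A) i i = char_poly_matrix (mat_delete A i i)"
      using i A by (auto simp: mat_delete_def char_poly_matrix_def)
    then show ?thesis using i A
      by (simp add: adj_mat_def cofactor_def char_poly_def char_poly_matrix_def)
  qed
  then have "mat_trace (adj_coeff A k) = coeff (\<Sum>i<d. char_poly (mat_delete A i i)) k"
    using A by (simp add: mat_trace_def adj_coeff_def coeff_sum)
  then show ?thesis by (simp add: pderiv_char_poly[OF A, symmetric] coeff_pderiv)
qed

text \<open>\<open>adj_coeff_Suc\<close> is unrolled \<open>n\<close> times under the trace. The
  remainder stays explicit so that the start and the number of steps can be chosen later.\<close>

lemma trace_pow_adj_coeff:
  assumes A: "A \<in> carrier_mat d d"
  shows "mat_trace (A ^\<^sub>m m * adj_coeff A k) =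
    (\<Sum>j<n. coeff (char_poly A) (Suc k + j) * mat_trace (A ^\<^sub>m (m + j))) +
    mat_trace (A ^\<^sub>m (m + n) * adj_coeff A (k + n))"
proof (induct n)
  case (Suc n)
  have "A ^\<^sub>m (m + n) * adj_coeff A (k + n) =
      A ^\<^sub>m (m + n) * (coeff (char_poly A) (Suc (k + n)) \<cdot>\<^sub>m 1\<^sub>m d) +
      A ^\<^sub>m (m + n) * (A * adj_coeff A (Suc (k + n)))"
    unfolding adj_coeff_Suc[OF A, of "k + n"]
    using A pow_carrier_mat[OF A] by (intro mult_add_distrib_mat[of _ d d]) auto
  also have "A ^\<^sub>m (m + n) * (coeff (char_poly A) (Suc (k + n)) \<cdot>\<^sub>m 1\<^sub>m d) =
      coeff (char_poly A) (Suc (k + n)) \<cdot>\<^sub>m A ^\<^sub>m (m + n)"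
    using mult_smult_distrib[OF pow_carrier_mat[OF A] one_carrier_mat]
      right_mult_one_mat[OF pow_carrier_mat[OF A]] by metis
  also have "A ^\<^sub>m (m + n) * (A * adj_coeff A (Suc (k + n))) = A ^\<^sub>m (m + Suc n) * adj_coeff A (k + Suc n)"
    using assoc_mult_mat[OF pow_carrier_mat[OF A] A adj_coeff_carrier[OF A]] by simp
  finally have "mat_trace (A ^\<^sub>m (m + n) * adj_coeff A (k + n)) =
      coeff (char_poly A) (Suc (k + n)) * mat_trace (A ^\<^sub>m (m + n)) +
      mat_trace (A ^\<^sub>m (m + Suc n) * adj_coeff A (k + Suc n))"
    using mat_trace_add[of "coeff (char_poly A) (Suc (k + n)) \<cdot>\<^sub>m A ^\<^sub>m (m + n)" d]
      mat_trace_smult[OF pow_carrier_mat[OF A]]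
      mult_carrier_mat[OF pow_carrier_mat[OF A] adj_coeff_carrier[OF A]] pow_carrier_mat[OF A]
    by (metis smult_carrier_mat)
  then show ?case using Suc by (simp add: add.assoc)
qed simp

lemma adj_coeff_eventually_0:
  assumes A: "A \<in> carrier_mat d d"
  shows "\<exists>N. \<forall>k\<ge>N. adj_coeff A k = 0\<^sub>m d d"
proof -
  let ?J = "\<lambda>ij. adj_mat (char_poly_matrix A) $$ ij"
  define N where "N = Suc (\<Sum>ij\<in>{..<d} \<times> {..<d}. degree (?J ij))"
  have "adj_coeff A k = 0\<^sub>m d d" if k: "k \<ge> N" for k
  proof (rule eq_matI)
    fix i j assume "i < dim_row (0\<^sub>m d d :: 'a mat)" "j < dim_col (0\<^sub>m d d :: 'a mat)"
    then have ij: "i < d" "j < d" by simp_all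
    then have "degree (?J (i, j)) \<le> (\<Sum>ij\<in>{..<d} \<times> {..<d}. degree (?J ij))"
      by (intro member_le_sum) auto
    then have "degree (?J (i, j)) < k" using k by (simp add: N_def)
    then show "adj_coeff A k $$ (i, j) = 0\<^sub>m d d $$ (i, j)"
      using ij A by (simp add: adj_coeff_def coeff_eq_0)
  qed (use A in \<open>simp_all add: adj_coeff_def\<close>)
  then show ?thesis by blast
qed

text \<open>Beyond index \<open>d\<close> the characteristic polynomial has no coefficients, so
  unrolling carries the trace unchanged to an index where \<open>adj_coeff\<close> vanishes. A crude
  bound on the degree of the adjugate thus suffices.\<close>

lemma trace_pow_adj_coeff_dim:
  assumes A: "A \<in> carrier_mat d d"
  shows "mat_trace (A ^\<^sub>m m * adj_coeff A d) = 0"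
proof -
  obtain N where N: "\<forall>k\<ge>N. adj_coeff A k = 0\<^sub>m d d" using adj_coeff_eventually_0[OF A] by blast
  have "coeff (char_poly A) (Suc d + j) = 0" for j
    using degree_monic_char_poly[OF A] by (intro coeff_eq_0) simp
  then have "mat_trace (A ^\<^sub>m m * adj_coeff A d) = mat_trace (A ^\<^sub>m (m + N) * adj_coeff A (d + N))"
    using trace_pow_adj_coeff[OF A, of m d N] by simp
  also have "\<dots> = mat_trace (0\<^sub>m d d)"
    using N right_mult_zero_mat[OF pow_carrier_mat[OF A]] by simp
  finally show ?thesis by (simp add: mat_trace_def)
qed

text \<open>The power series \<open>det (1 - x A)\<close>, that is, the reversed characteristic polynomial.\<close>

definition char_fps :: "'a::comm_ring_1 mat \<Rightarrow> 'a fps" where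
  "char_fps A = Abs_fps (\<lambda>n. if n \<le> dim_row A then coeff (char_poly A) (dim_row A - n) else 0)"

definition trace_fps :: "'a::comm_ring_1 mat \<Rightarrow> 'a fps" where
  "trace_fps A = Abs_fps (\<lambda>n. mat_trace (A ^\<^sub>m n))"

lemma char_fps_nth:
  "A \<in> carrier_mat d d \<Longrightarrow> fps_nth (char_fps A) n = (if n \<le> d then coeff (char_poly A) (d - n) else 0)"
  by (simp add: char_fps_def)

text \<open>For n < d the convolution is the trace of an adjugate coefficient, hence a coefficient
  of the derivative. For n >= d it vanishes in the manner of Cayley-Hamilton; the right-hand side
  does too, through its first factor at n = d and its second one beyond.\<close>

lemma trace_fps_mult_char_fps_nth:
  fixes A :: "'a::idom mat"
  assumes A: "A \<in> carrier_mat d d"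
  shows "fps_nth (trace_fps A * char_fps A) n = (of_nat d - of_nat n) * fps_nth (char_fps A) n"
proof (cases "n < d")
  case True
  let ?f = "coeff (char_poly A)"
  have "fps_nth (trace_fps A * char_fps A) n = (\<Sum>j<Suc n. ?f (Suc (d - n - 1) + j) * mat_trace (A ^\<^sub>m (0 + j)))"
    unfolding fps_mult_nth
    using True by (intro sum.cong) (auto simp: char_fps_nth[OF A] trace_fps_def mult.commute
        intro!: arg_cong2[of _ _ _ _ "(*)"] arg_cong[of _ _ ?f])
  \<comment> \<open>Unrolling n + 1 times from index d - n - 1 ends exactly at index d, where the
    remainder vanishes.\<close>
  also have "\<dots> = mat_trace (A ^\<^sub>m 0 * adj_coeff A (d - n - 1))"
    using trace_pow_adj_coeff[OF A, of 0 "d - n - 1" "Suc n"] trace_pow_adj_coeff_dim[OF A, of "Suc n"] True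
    by simp
  also have "A ^\<^sub>m 0 * adj_coeff A (d - n - 1) = adj_coeff A (d - n - 1)"
    using left_mult_one_mat[OF adj_coeff_carrier[OF A]] A by simp
  also have "mat_trace (adj_coeff A (d - n - 1)) = of_nat (d - n) * ?f (d - n)"
    using mat_trace_adj_coeff[OF A, of "d - n - 1"] True Suc_diff_Suc[OF True] by simp
  finally show ?thesis using True by (simp add: char_fps_nth[OF A] of_nat_diff)
next
  case False
  let ?f = "coeff (char_poly A)" and ?m = "n - d"
  have "fps_nth (trace_fps A * char_fps A) n =
      (\<Sum>i\<in>{?m..n}. mat_trace (A ^\<^sub>m i) * ?f (d - (n - i)))"
    unfolding fps_mult_nth
    using False by (intro sum.mono_neutral_cong_right) (auto simp: char_fps_nth[OF A] trace_fps_def)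
  also have "\<dots> = (\<Sum>j<Suc d. mat_trace (A ^\<^sub>m (?m + j)) * ?f j)"
    using False by (intro sum.reindex_bij_witness[of _ "\<lambda>j. ?m + j" "\<lambda>i. i - ?m"]) (auto simp: add.commute)
  also have "\<dots> = ?f 0 * mat_trace (A ^\<^sub>m ?m) + (\<Sum>j<d. ?f (Suc 0 + j) * mat_trace (A ^\<^sub>m (Suc ?m + j)))"
    unfolding sum.lessThan_Suc_shift by (simp add: mult.commute del: pow_mat.simps)
  also have "\<dots> = ?f 0 * mat_trace (A ^\<^sub>m ?m) + mat_trace (A ^\<^sub>m Suc ?m * adj_coeff A 0)"
    using trace_pow_adj_coeff[OF A, of "Suc ?m" 0 d] trace_pow_adj_coeff_dim[OF A, of "Suc ?m + d"]
    by (simp del: pow_mat.simps)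
  also have "\<dots> = mat_trace (A ^\<^sub>m ?m * (?f 0 \<cdot>\<^sub>m 1\<^sub>m d + A * adj_coeff A 0))"
  proof -
    have P: "A ^\<^sub>m ?m \<in> carrier_mat d d" by (rule pow_carrier_mat[OF A])
    have Q: "adj_coeff A 0 \<in> carrier_mat d d" using A by simp
    have "A ^\<^sub>m ?m * (?f 0 \<cdot>\<^sub>m 1\<^sub>m d + A * adj_coeff A 0) = ?f 0 \<cdot>\<^sub>m A ^\<^sub>m ?m + A ^\<^sub>m Suc ?m * adj_coeff A 0"
      using mult_add_distrib_mat[OF P smult_carrier_mat[OF one_carrier_mat] mult_carrier_mat[OF A Q], of "?f 0"]
        mult_smult_distrib[OF P one_carrier_mat, of "?f 0"] right_mult_one_mat[OF P] assoc_mult_mat[OF P A Q]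
      by simp
    then show ?thesis
      using mat_trace_add[OF smult_carrier_mat[OF P], of "A ^\<^sub>m Suc ?m * adj_coeff A 0" "?f 0"]
        mat_trace_smult[OF P, of "?f 0"] mult_carrier_mat[OF pow_carrier_mat[OF A, of "Suc ?m"] Q]
      by metis
  qed
  also have "\<dots> = 0"
    unfolding adj_coeff_0[OF A] right_mult_zero_mat[OF pow_carrier_mat[OF A]] by (simp add: mat_trace_def)
  finally show ?thesis using False by (cases "n = d") (auto simp: char_fps_nth[OF A])
qed

text \<open>The quotient-free form of x P' / P = - (sum over n >= 1 of tr(A^n) x^n);
  \<open>of_nat d\<close> compensates for the term of \<open>trace_fps\<close> at n = 0.\<close>

lemma newton_identities_fps:
  fixes A :: "'a::idom mat"
  assumes A: "A \<in> carrier_mat d d"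
  shows "fps_X * fps_deriv (char_fps A) = of_nat d * char_fps A - trace_fps A * char_fps A"
proof (rule fps_ext)
  fix n
  have "fps_nth (of_nat d * char_fps A) n = of_nat d * fps_nth (char_fps A) n"
    by (metis fps_mult_left_const_nth fps_of_nat)
  then have "fps_nth (of_nat d * char_fps A - trace_fps A * char_fps A) n =
      of_nat n * fps_nth (char_fps A) n"
    by (simp only: fps_sub_nth trace_fps_mult_char_fps_nth[OF A]) (simp add: algebra_simps)
  then show "fps_nth (fps_X * fps_deriv (char_fps A)) n =
      fps_nth (of_nat d * char_fps A - trace_fps A * char_fps A) n"
    by (cases n) simp_all
qed

section \<open>Logarithm and exponential modulo the uniformiser\<close>

text \<open>One step of Legendre's formula: the multiples of \<open>p\<close> up to \<open>k\<close>
  contribute the power of \<open>p\<close> and the smaller factorial; all other factors are prime to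
  \<open>p\<close>.\<close>

lemma fact_prime_decomposition:
  assumes p: "prime (p::nat)"
  shows "\<exists>m. fact k = p ^ (k div p) * fact (k div p) * m \<and> \<not> p dvd m"
proof (induct k)
  case 0
  then show ?case using p not_prime_unit by (intro exI[of _ 1]) auto
next
  case (Suc k)
  then obtain m where m: "fact k = p ^ (k div p) * fact (k div p) * m" "\<not> p dvd m" by blast
  show ?case
  proof (cases "p dvd Suc k")
    case True
    then have q: "Suc k div p = Suc (k div p)" by (simp add: div_Suc dvd_eq_mod_eq_0)
    then have k: "Suc k = p * Suc (k div p)" using True by (metis dvd_mult_div_cancel)
    have "fact (Suc k) = Suc k * (fact k :: nat)" by simp
    also have "\<dots> = p ^ (Suc k div p) * fact (Suc k div p) * m"
      unfolding q m(1) by (subst k) (simp add: algebra_simps)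
    finally show ?thesis using m(2) by blast
  next
    case False
    then have q: "Suc k div p = k div p" by (simp add: div_Suc dvd_eq_mod_eq_0)
    have "fact (Suc k) = Suc k * (fact k :: nat)" by simp
    also have "\<dots> = p ^ (Suc k div p) * fact (Suc k div p) * (Suc k * m)"
      unfolding q m(1) by (simp add: algebra_simps)
    finally show ?thesis using m(2) False p by (metis prime_dvd_mult_iff)
  qed
qed

text \<open>What the series arguments take from the ring: characteristic zero, invertibility of
  integers prime to \<open>p\<close>, and the ramification bound in the form
  \<open>p_dvd\<close>.\<close>

locale small_ramification =
  fixes p :: nat and \<pi> :: "'a::idom"
  assumes prime_p: "prime p"
    and of_nat_eq_0: "\<And>n. of_nat n = (0::'a) \<Longrightarrow> n = 0"
    and of_nat_unit: "\<And>n. \<not> p dvd n \<Longrightarrow> (of_nat n :: 'a) dvd 1"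
    and p_dvd: "(of_nat p :: 'a) dvd \<pi> ^ (p - 1)"
begin

text \<open>Legendre's bound \<open>v\<^sub>p(k!) \<le> (k - 1) / (p - 1)\<close>; it makes both \<open>\<pi>\<^sup>k / k\<close> and
  \<open>\<pi>\<^sup>k / k!\<close> divisible by \<open>\<pi>\<close>.\<close>

lemma fact_dvd: "(of_nat (fact k) :: 'a) dvd \<pi> ^ (k - 1)"
proof (induct k rule: less_induct)
  case (less k)
  show ?case
  proof (cases "k < p")
    case True
    then have "\<not> p dvd fact k" using prime_dvd_fact_iff[OF prime_p] by simp
    then show ?thesis using of_nat_unit dvd_trans one_dvd by blast
  next
    case False
    define q where "q = k div p"
    have p1: "1 < p" using prime_p by (rule prime_gt_1_nat)
    have q: "1 \<le> q" "q < k" "p * q \<le> k"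
      using False p1 by (simp_all add: q_def div_greater_zero_iff Suc_le_eq)
    obtain m where m: "fact k = p ^ q * fact q * m" "\<not> p dvd m"
      using fact_prime_decomposition[OF prime_p] unfolding q_def by blast
    have "(of_nat p :: 'a) ^ q * of_nat (fact q) * of_nat m dvd (\<pi> ^ (p - 1)) ^ q * \<pi> ^ (q - 1) * 1"
      by (intro mult_dvd_mono dvd_power_same p_dvd less q of_nat_unit m(2))
    then have "(of_nat (fact k) :: 'a) dvd \<pi> ^ ((p - 1) * q + (q - 1))"
      unfolding m(1) by (simp add: power_mult power_add)
    \<comment> \<open>Because q >= 1, the two exponents add up to p q - 1.\<close>
    moreover have "(p - 1) * q + (q - 1) \<le> k - 1"
    proof -
      have "(p - 1) * q + q = p * q" using p1 by (cases p) auto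
      then show ?thesis using q by linarith
    qed
    ultimately show ?thesis using le_imp_power_dvd dvd_trans by blast
  qed
qed

text \<open>The witness is the quotient of \<open>\<pi> ^ k\<close> by k!, named without dividing.
  As k! already divides the power with exponent k - 1, one factor \<open>\<pi>\<close> is left
  over.\<close>

lemma power_eq_fact_mult: "\<exists>e. \<pi> ^ k = of_nat (fact k) * e \<and> (0 < k \<longrightarrow> \<pi> dvd e)"
proof (cases k)
  case (Suc m)
  obtain c where "\<pi> ^ m = of_nat (fact k) * c" using fact_dvd[of k] Suc by (auto simp: dvd_def)
  then have "\<pi> ^ k = of_nat (fact k) * (c * \<pi>)" using Suc by (simp add: mult_ac)
  then show ?thesis by (intro exI[of _ "c * \<pi>"]) simp
qed simp

lemma power_eq_nat_mult:
  assumes "0 < k"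
  shows "\<exists>l. \<pi> ^ k = of_nat k * l \<and> \<pi> dvd l"
proof -
  obtain e where e: "\<pi> ^ k = of_nat (fact k) * e" "\<pi> dvd e" using power_eq_fact_mult assms by blast
  have "fact k = k * (fact (k - 1) :: nat)" using assms by (simp add: fact_reduce)
  then have "\<pi> ^ k = of_nat k * (of_nat (fact (k - 1)) * e)" unfolding e(1) by (simp only: of_nat_mult mult.assoc)
  then show ?thesis using e(2) by (intro exI[of _ "of_nat (fact (k - 1)) * e"]) simp
qed

text \<open>\<open>G\<close> below is \<open>- log (P / Q)\<close>, obtained by substituting \<open>h\<close> into \<open>- log (1 - \<pi> x)\<close>.\<close>

lemma congruent_imp_traces_congruent:
  fixes P Q S T :: "'a fps" and d :: nat
  assumes P: "fps_X * fps_deriv P = of_nat d * P - S * P" and "fps_nth P 0 = 1"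
    and Q: "fps_X * fps_deriv Q = of_nat d * Q - T * Q" and "fps_nth Q 0 = 1"
    and cong: "\<And>n. \<pi> dvd fps_nth P n - fps_nth Q n"
  shows "\<exists>a. \<pi> dvd a \<and> fps_nth S n - fps_nth T n = of_nat n * a"
proof -
  let ?c = "fps_const \<pi>"
  \<comment> \<open>Both constant terms are 1, so \<open>r\<close> can vanish at 0; then
    \<open>h\<close> has no constant term and may be substituted into a power series.\<close>
  have "\<exists>r. fps_nth Q n - fps_nth P n = \<pi> * r \<and> (n = 0 \<longrightarrow> r = 0)" for n
  proof (cases "n = 0")
    case False
    obtain s where "fps_nth P n - fps_nth Q n = \<pi> * s" using cong[of n] unfolding dvd_def by blast
    then have "fps_nth Q n - fps_nth P n = \<pi> * (- s)" by (simp add: algebra_simps)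
    then show ?thesis using False by blast
  qed (use assms in simp)
  then obtain r where r: "\<And>n. fps_nth Q n - fps_nth P n = \<pi> * r n" "r 0 = 0" by metis
  \<comment> \<open>Chosen so that P / Q = 1 - \<pi> h.\<close>
  define h where "h = Abs_fps r * fps_left_inverse Q 1"
  have inv: "fps_left_inverse Q 1 * Q = 1" by (rule fps_left_inverse) (simp add: assms)
  have h0: "fps_nth h 0 = 0" by (simp add: h_def r)
  have "Q * h = Abs_fps r * (fps_left_inverse Q 1 * Q)" by (simp only: h_def mult_ac)
  then have Qh: "Abs_fps r = Q * h" unfolding inv by simp
  have "Q - P = ?c * Abs_fps r" by (rule fps_ext) (simp add: r)
  also note Qh
  finally have PQ: "P = Q * (1 - ?c * h)" by (simp add: algebra_simps)
  \<comment> \<open>\<open>l k\<close> stands for \<open>\<pi> ^ k\<close> divided by k, which makes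
    \<open>L\<close> the series - log (1 - \<pi> x).\<close>
  obtain l where l: "\<And>k. 0 < k \<Longrightarrow> \<pi> ^ k = of_nat k * l k" "\<And>k. 0 < k \<Longrightarrow> \<pi> dvd l k"
    using power_eq_nat_mult by metis
  define L where "L = Abs_fps (\<lambda>k. if k = 0 then 0 else l k)"
  define G where "G = L oo h"
  have L': "fps_nth (fps_deriv L) k = \<pi> ^ Suc k" for k
    using l(1)[of "Suc k"] by (simp add: L_def)
  have "(1 - ?c * fps_X) * fps_deriv L = ?c"
  proof (rule fps_ext)
    fix n
    have "fps_nth ((1 - ?c * fps_X) * fps_deriv L) n =
        fps_nth (fps_deriv L) n - \<pi> * fps_nth (fps_X * fps_deriv L) n"
      by (simp add: algebra_simps del: fps_deriv_nth)
    then show "fps_nth ((1 - ?c * fps_X) * fps_deriv L) n = fps_nth ?c n"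
      by (cases n) (simp_all add: L' del: fps_deriv_nth)
  qed
  then have "((1 - ?c * fps_X) * fps_deriv L) oo h = ?c" by simp
  then have "(1 - ?c * h) * (fps_deriv L oo h) = ?c"
    using h0 by (simp add: fps_compose_mult_distrib fps_compose_sub_distrib)
  then have G': "(1 - ?c * h) * fps_deriv G = ?c * fps_deriv h"
    unfolding G_def fps_compose_deriv[OF h0] by (simp add: mult.assoc[symmetric])
  \<comment> \<open>This leads to P' / P = Q' / Q - G', in a form free of quotients.\<close>
  have "fps_deriv P = fps_deriv Q * (1 - ?c * h) - Q * (?c * fps_deriv h)"
    unfolding PQ by (simp add: algebra_simps)
  also have "\<dots> = fps_deriv Q * (1 - ?c * h) - P * fps_deriv G"
    unfolding G'[symmetric] PQ by (simp add: algebra_simps)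
  finally have P': "fps_deriv P = fps_deriv Q * (1 - ?c * h) - P * fps_deriv G" .
  have "fps_X * fps_deriv P = (fps_X * fps_deriv Q) * (1 - ?c * h) - P * (fps_X * fps_deriv G)"
    unfolding P' by (simp add: algebra_simps)
  also have "\<dots> = of_nat d * P - T * P - P * (fps_X * fps_deriv G)"
    unfolding Q PQ by (simp add: algebra_simps)
  finally have "(S - T - fps_X * fps_deriv G) * P = 0"
    unfolding P by (simp add: algebra_simps)
  moreover have "P \<noteq> 0" using assms by auto
  ultimately have "S - T = fps_X * fps_deriv G" by simp
  then have "fps_nth S n - fps_nth T n = fps_nth (fps_X * fps_deriv G) n" by (metis fps_sub_nth)
  also have "\<dots> = of_nat n * fps_nth G n" by (cases n) simp_all
  finally have "fps_nth S n - fps_nth T n = of_nat n * fps_nth G n" .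
  moreover have "\<pi> dvd fps_nth G n"
    unfolding G_def fps_compose_nth by (intro dvd_sum) (auto simp: L_def l(2))
  ultimately show ?thesis by blast
qed

text \<open>The equation is a recursion for n times the n-th coefficient: the i = 0 term of the
  convolution cancels against \<open>of_nat d\<close>, only lower coefficients remain, and
  characteristic zero allows cancelling n.\<close>

lemma fps_unique_solution:
  fixes P W S T :: "'a fps" and d :: nat
  assumes P: "fps_X * fps_deriv P = of_nat d * P - S * P"
    and W: "fps_X * fps_deriv W = of_nat d * W - T * W"
    and "fps_nth P 0 = fps_nth W 0" "fps_nth S 0 = of_nat d"
    and ST: "\<And>i. i \<le> N \<Longrightarrow> fps_nth S i = fps_nth T i"
  shows "n \<le> N \<Longrightarrow> fps_nth P n = fps_nth W n"
proof (induct n rule: less_induct)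
  case (less n)
  have rec: "of_nat n * fps_nth Z n = - (\<Sum>i\<in>{1..n}. fps_nth U i * fps_nth Z (n - i))"
    if "fps_X * fps_deriv Z = of_nat d * Z - U * Z" "fps_nth U 0 = of_nat d" for Z U :: "'a fps"
  proof -
    have "of_nat n * fps_nth Z n = fps_nth (fps_X * fps_deriv Z) n" by (cases n) simp_all
    also have "\<dots> = of_nat d * fps_nth Z n - (\<Sum>i=0..n. fps_nth U i * fps_nth Z (n - i))"
      unfolding that(1) fps_of_nat[symmetric] by (simp only: fps_sub_nth fps_mult_left_const_nth fps_mult_nth[of U Z])
    also have "(\<Sum>i=0..n. fps_nth U i * fps_nth Z (n - i)) =
        of_nat d * fps_nth Z n + (\<Sum>i\<in>{1..n}. fps_nth U i * fps_nth Z (n - i))"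
      using that(2) by (simp add: sum.atLeast_Suc_atMost)
    finally show ?thesis by simp
  qed
  show ?case
  proof (cases "n = 0")
    case False
    have "fps_nth T 0 = of_nat d" using ST[of 0] assms(4) by simp
    then have "of_nat n * fps_nth P n = of_nat n * fps_nth W n"
      unfolding rec[OF P assms(4)] rec[OF W \<open>fps_nth T 0 = of_nat d\<close>]
      using less ST by simp
    then show ?thesis using False of_nat_eq_0 by auto
  qed (use assms in simp)
qed

text \<open>\<open>V\<close> below is \<open>P / Q = exp (\<pi> g)\<close> up to order \<open>N\<close>.\<close>

lemma traces_congruent_imp_congruent:
  fixes P Q S T :: "'a fps" and d N :: nat
  assumes P: "fps_X * fps_deriv P = of_nat d * P - S * P" and "fps_nth P 0 = 1"
    and Q: "fps_X * fps_deriv Q = of_nat d * Q - T * Q" and "fps_nth Q 0 = 1"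
    and S0: "fps_nth S 0 = of_nat d" and T0: "fps_nth T 0 = of_nat d"
    and cong: "\<And>n. n \<in> {1..N} \<Longrightarrow> \<exists>a. \<pi> dvd a \<and> fps_nth S n - fps_nth T n = of_nat n * a"
    and n: "n \<le> N"
  shows "\<pi> dvd fps_nth P n - fps_nth Q n"
proof -
  let ?c = "fps_const \<pi>"
  \<comment> \<open>The sign matches log (P / Q), whose n-th coefficient is minus the trace
    difference divided by n; it becomes \<pi> times \<open>b n\<close>.\<close>
  have "\<exists>b. fps_nth S n - fps_nth T n = - (of_nat n * (\<pi> * b))" if mem: "n \<in> {1..N}" for n
  proof -
    obtain a where a: "\<pi> dvd a" "fps_nth S n - fps_nth T n = of_nat n * a" using cong[OF mem] by blast
    from a(1) obtain b where "a = \<pi> * b" unfolding dvd_def by blast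
    then show ?thesis using a(2) by (intro exI[of _ "- b"]) simp
  qed
  then obtain b where b: "\<And>n. n \<in> {1..N} \<Longrightarrow> fps_nth S n - fps_nth T n = - (of_nat n * (\<pi> * b n))"
    using bchoice[of "{1..N}" "\<lambda>n b. fps_nth S n - fps_nth T n = - (of_nat n * (\<pi> * b))"] by blast
  \<comment> \<open>The hypothesis says nothing beyond \<open>N\<close>, so \<open>g\<close> is cut
    off there.\<close>
  define g where "g = Abs_fps (\<lambda>n. if n \<in> {1..N} then b n else 0)"
  have g0: "fps_nth g 0 = 0" by (simp add: g_def)
  \<comment> \<open>\<open>e k\<close> stands for \<open>\<pi> ^ k\<close> divided by k!, so
    \<open>Abs_fps e\<close> is exp (\<pi> x), characterised by its differential equation.\<close>
  obtain e where e: "\<And>k. \<pi> ^ k = of_nat (fact k) * e k" "\<And>k. 0 < k \<Longrightarrow> \<pi> dvd e k"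
    using power_eq_fact_mult by metis
  have e0: "e 0 = 1" using e(1)[of 0] by simp
  define V where "V = Abs_fps e oo g"
  have "fps_deriv (Abs_fps e) = ?c * Abs_fps e"
  proof (rule fps_ext)
    fix k
    have "of_nat (fact k) * (of_nat (Suc k) * e (Suc k)) = \<pi> ^ Suc k"
      unfolding e(1)[of "Suc k"] by (simp add: algebra_simps)
    also have "\<dots> = of_nat (fact k) * (\<pi> * e k)" using e(1)[of k] by simp
    finally have "of_nat (Suc k) * e (Suc k) = \<pi> * e k"
      using of_nat_eq_0[of "fact k"] by (simp only: mult_cancel_left) auto
    then show "fps_nth (fps_deriv (Abs_fps e)) k = fps_nth (?c * Abs_fps e) k" by simp
  qed
  then have V': "fps_deriv V = ?c * V * fps_deriv g"
    unfolding V_def fps_compose_deriv[OF g0] by (simp add: fps_const_mult_apply_left)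
  have V0: "fps_nth V 0 = 1" by (simp add: V_def e0)
  have V_cong: "\<pi> dvd fps_nth (V - 1) m" for m
  proof -
    have "fps_nth V m = e 0 * fps_nth (g ^ 0) m + (\<Sum>i\<in>{1..m}. e i * fps_nth (g ^ i) m)"
      unfolding V_def fps_compose_nth by (simp add: sum.atLeast_Suc_atMost)
    then have "fps_nth (V - 1) m = (\<Sum>i\<in>{1..m}. e i * fps_nth (g ^ i) m)" by (simp add: e0)
    then show ?thesis using e(2) by (auto intro!: dvd_sum)
  qed
  \<comment> \<open>\<open>Q * V\<close> satisfies the equation of \<open>P\<close> with
    \<open>T'\<close> in place of \<open>S\<close>. The two agree up to \<open>N\<close>, so
    uniqueness identifies \<open>P\<close> with \<open>Q * V\<close> to that order.\<close>
  define T' where "T' = T - fps_X * (?c * fps_deriv g)"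
  have "fps_X * fps_deriv (Q * V) = (fps_X * fps_deriv Q) * V + Q * (fps_X * fps_deriv V)"
    by (simp add: algebra_simps)
  also have "\<dots> = of_nat d * (Q * V) - T' * (Q * V)"
    unfolding Q V' T'_def by (simp add: algebra_simps)
  finally have W: "fps_X * fps_deriv (Q * V) = of_nat d * (Q * V) - T' * (Q * V)" .
  have "fps_nth S i = fps_nth T' i" if "i \<le> N" for i
  proof (cases "i = 0")
    case False
    then have "fps_nth T' i = fps_nth T i - of_nat i * (\<pi> * b i)"
      using that by (cases i) (simp_all add: T'_def g_def algebra_simps)
    then show ?thesis using b[of i] that False by (simp add: diff_eq_eq)
  qed (simp add: T'_def S0 T0)
  then have "fps_nth P n = fps_nth (Q * V) n"
    using fps_unique_solution[OF P W _ S0 _ n] assms V0 by simp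
  then have "fps_nth P n - fps_nth Q n = fps_nth (Q * (V - 1)) n" by (simp add: algebra_simps)
  also have "\<pi> dvd \<dots>"
    unfolding fps_mult_nth by (intro dvd_sum dvd_mult V_cong)
  finally show ?thesis .
qed

end

section \<open>Comparison of traces\<close>

text \<open>A nonzero element is a unit times a power of \<open>\<pi>\<close> and reduces to zero
  exactly when the exponent is positive. As p is a unit times \<open>\<pi> ^ e\<close>, the bound on
  e gives \<open>p_dvd\<close>.\<close>

lemma padic_integer_ringE:
  fixes red :: "'a::idom \<Rightarrow> 'b::field"
  assumes O: "padic_integer_ring p e red" and e: "e \<le> p - 1"
  obtains \<pi> where "small_ramification p \<pi>" "\<And>x. red x = 0 \<longleftrightarrow> \<pi> dvd x" "comm_ring_hom red"
proof -
  have p: "prime p" and inj: "inj (of_nat :: nat \<Rightarrow> 'a)"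
    and add: "\<And>x y. red (x + y) = red x + red y" and mult: "\<And>x y. red (x * y) = red x * red y"
    and one: "red 1 = 1" and char_p: "(of_nat p :: 'b) = 0"
    using O unfolding padic_integer_ring_def by simp_all
  have "\<exists>\<pi>::'a. red \<pi> = 0 \<and> (\<forall>x. x \<noteq> 0 \<longrightarrow> (\<exists>u k. u dvd 1 \<and> x = u * \<pi> ^ k)) \<and>
      (\<exists>u. u dvd 1 \<and> (of_nat p :: 'a) = u * \<pi> ^ e)"
    using O unfolding padic_integer_ring_def by (elim conjE exE, intro exI conjI) assumption+
  then obtain \<pi> u where \<pi>: "red \<pi> = 0" "\<And>x. x \<noteq> 0 \<Longrightarrow> \<exists>u k. u dvd 1 \<and> x = u * \<pi> ^ k"
    and u: "u dvd 1" "(of_nat p :: 'a) = u * \<pi> ^ e"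
    by (elim exE conjE) auto
  have zero: "red 0 = 0" using add[of 0 0] unfolding add_0_right add_cancel_right_right .
  interpret hom: comm_ring_hom red
    by unfold_locales (simp_all add: add mult one zero)
  have unit_red: "red x \<noteq> 0" if "x dvd 1" for x
  proof -
    obtain y where "1 = x * y" using \<open>x dvd 1\<close> unfolding dvd_def by blast
    then have "red x * red y = 1" using mult one by metis
    then show ?thesis by auto
  qed
  have dvd: "red x = 0 \<longleftrightarrow> \<pi> dvd x" for x
  proof
    assume x: "red x = 0"
    show "\<pi> dvd x"
    proof (cases "x = 0")
      case False
      then obtain v k where v: "v dvd 1" "x = v * \<pi> ^ k" using \<pi>(2) by blast
      then have "k \<noteq> 0" using unit_red x by (cases k) auto
      then show ?thesis using v(2) by (simp add: dvd_power)
    qed simp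
  next
    assume "\<pi> dvd x"
    then show "red x = 0" using \<pi>(1) mult unfolding dvd_def by auto
  qed
  have unit: "x dvd 1" if "red x \<noteq> 0" for x
  proof -
    have "x \<noteq> 0" using that zero by auto
    then obtain v k where v: "v dvd 1" "x = v * \<pi> ^ k" using \<pi>(2) by blast
    then have "k = 0" using \<open>red x \<noteq> 0\<close> \<pi>(1) mult by (cases k) auto
    then show ?thesis using v by simp
  qed
  have red_of_nat: "red (of_nat n) = of_nat n" for n
    by (induct n) (simp_all add: zero one add)
  have "small_ramification p \<pi>"
  proof
    show "prime p" by (rule p)
    show "n = 0" if "of_nat n = (0::'a)" for n
      using that injD[OF inj, of n 0] by simp
    show "(of_nat n :: 'a) dvd 1" if n: "\<not> p dvd n" for n
    proof (rule unit)
      have "n \<noteq> 0" using n by (intro notI) simp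
      \<comment> \<open>Bezout inverts \<open>n\<close> modulo \<open>p\<close>. Since p is zero in
        the residue field, \<open>n\<close> has nonzero image there and is a unit in the
        ring.\<close>
      then obtain a b where "n * a = p * b + gcd n p" using bezout_nat by blast
      moreover have "gcd n p = 1" using prime_imp_coprime[OF p n] unfolding coprime_iff_gcd_eq_1 by (subst gcd.commute)
      ultimately have "of_nat (n * a) = (of_nat (p * b + 1) :: 'b)" by simp
      then have "of_nat n * of_nat a = (1::'b)" by (simp add: char_p)
      then show "red (of_nat n) \<noteq> 0" unfolding red_of_nat by auto
    qed
    obtain u' where u': "1 = u * u'" using u(1) unfolding dvd_def by blast
    have "\<pi> ^ e = of_nat p * u'"
      unfolding u(2) using u'[symmetric] by (simp add: mult.commute mult.left_commute[of u'])
    then have "(of_nat p :: 'a) dvd \<pi> ^ e" by simp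
    then show "(of_nat p :: 'a) dvd \<pi> ^ (p - 1)" using e le_imp_power_dvd dvd_trans by blast
  qed
  then show ?thesis using that dvd hom.comm_ring_hom_axioms by blast
qed

text \<open>Reduction commutes with forming the characteristic polynomial, and
  \<open>char_fps\<close> lists its coefficients backwards; above degree d there is nothing to
  compare.\<close>

lemma char_poly_eq_iff_char_fps_congruent:
  fixes red :: "'a::idom \<Rightarrow> 'b::field"
  assumes hom: "comm_ring_hom red" and A: "A \<in> carrier_mat d d" and B: "B \<in> carrier_mat d d"
  shows "char_poly (map_mat red A) = char_poly (map_mat red B) \<longleftrightarrow>
    (\<forall>n\<le>d. red (fps_nth (char_fps A) n - fps_nth (char_fps B) n) = 0)"
proof -
  interpret comm_ring_hom red by (rule hom)
  let ?f = "coeff (char_poly A)" and ?g = "coeff (char_poly B)"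
  have "char_poly (map_mat red A) = char_poly (map_mat red B) \<longleftrightarrow> (\<forall>n. red (?f n - ?g n) = 0)"
    unfolding char_poly_hom[OF A] char_poly_hom[OF B] poly_eq_iff by (simp add: hom_minus)
  also have "\<dots> \<longleftrightarrow> (\<forall>n\<le>d. red (?f n - ?g n) = 0)"
  proof -
    have "?f n - ?g n = 0" if "\<not> n \<le> d" for n
      using that degree_monic_char_poly[OF A] degree_monic_char_poly[OF B] by (simp add: coeff_eq_0)
    then show ?thesis using hom_zero by metis
  qed
  also have "\<dots> \<longleftrightarrow> (\<forall>n\<le>d. red (?f (d - n) - ?g (d - n)) = 0)"
    by (metis diff_diff_cancel diff_le_self)
  also have "\<dots> \<longleftrightarrow> (\<forall>n\<le>d. red (fps_nth (char_fps A) n - fps_nth (char_fps B) n) = 0)"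
    by (simp add: char_fps_nth[OF A] char_fps_nth[OF B])
  finally show ?thesis .
qed

lemma char_fps_nth_0: "A \<in> carrier_mat d d \<Longrightarrow> fps_nth (char_fps A) 0 = 1"
  using degree_monic_char_poly[of A d] by (simp add: char_fps_nth)

lemma trace_fps_nth_0: "A \<in> carrier_mat d d \<Longrightarrow> fps_nth (trace_fps A) 0 = of_nat d"
  by (simp add: trace_fps_def mat_trace_def)

theorem theorem6p1:
  fixes p e d :: nat and red :: "'a::idom \<Rightarrow> 'b::field"
    and A B :: "'a mat"
  assumes "padic_integer_ring p e red"
    and "e \<le> p - 1"
    and "A \<in> carrier_mat d d" and "B \<in> carrier_mat d d"
  shows "ss_iso (map_mat red A) (map_mat red B) \<longleftrightarrow>
    (\<forall>n\<in>{1..d}. \<exists>a. red a = 0 \<and>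
        mat_trace (A ^\<^sub>m n) - mat_trace (B ^\<^sub>m n) = of_nat n * a)"
proof -
  note A = assms(3) and B = assms(4)
  obtain \<pi> where "small_ramification p \<pi>" and red: "\<And>x. red x = 0 \<longleftrightarrow> \<pi> dvd x"
    and hom: "comm_ring_hom red"
    using padic_integer_ringE[OF assms(1,2)] by blast
  interpret small_ramification p \<pi> by fact
  let ?P = "char_fps A" and ?Q = "char_fps B"
  note newton = newton_identities_fps[OF A] newton_identities_fps[OF B]
  have "ss_iso (map_mat red A) (map_mat red B) \<longleftrightarrow> (\<forall>n\<le>d. \<pi> dvd fps_nth ?P n - fps_nth ?Q n)"
    using ss_iso_iff_char_poly_eq[of "map_mat red A" d "map_mat red B"] A B
      char_poly_eq_iff_char_fps_congruent[OF hom A B] red by simp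
  also have "\<dots> \<longleftrightarrow> (\<forall>n\<in>{1..d}. \<exists>a. \<pi> dvd a \<and>
      fps_nth (trace_fps A) n - fps_nth (trace_fps B) n = of_nat n * a)"
  proof
    assume cong: "\<forall>n\<le>d. \<pi> dvd fps_nth ?P n - fps_nth ?Q n"
    \<comment> \<open>The logarithm argument takes the congruence at every index; beyond d both
      coefficients are zero.\<close>
    have "\<pi> dvd fps_nth ?P n - fps_nth ?Q n" for n
      using cong by (cases "n \<le> d") (simp_all add: char_fps_nth[OF A] char_fps_nth[OF B])
    from congruent_imp_traces_congruent[OF newton(1) char_fps_nth_0[OF A] newton(2) char_fps_nth_0[OF B] this]
    show "\<forall>n\<in>{1..d}. \<exists>a. \<pi> dvd a \<and>
      fps_nth (trace_fps A) n - fps_nth (trace_fps B) n = of_nat n * a" by (intro ballI)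
  next
    assume cong: "\<forall>n\<in>{1..d}. \<exists>a. \<pi> dvd a \<and>
      fps_nth (trace_fps A) n - fps_nth (trace_fps B) n = of_nat n * a"
    show "\<forall>n\<le>d. \<pi> dvd fps_nth ?P n - fps_nth ?Q n"
      using traces_congruent_imp_congruent[OF newton(1) char_fps_nth_0[OF A] newton(2) char_fps_nth_0[OF B]
          trace_fps_nth_0[OF A] trace_fps_nth_0[OF B] bspec[OF cong]] by (intro allI impI)
  qed
  finally show ?thesis by (simp add: red trace_fps_def)
qed

end
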